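(* Let $\{T(t)\}_{t\ge 0}$ be a $C_0$-semigroup (of normal operators) on a complex Hilbert space $(X,(\cdot,\cdot),\|\cdot\|)$, $X\neq\{0\}$, generated by a normal operator $A$ with spectral measure $E_A(\cdot)$. Then $$\|T(t)\|\le e^{\omega_0 t},\quad t\ge 0,$$ with $\omega_0=s(A)$ and $M_0:=1$ being the best stability constants, i.e., the smallest numbers $\omega\in\mathbb{R}$ and $M\ge 1$ for which the estimate $\|T(t)\|\le Me^{\omega t}$, $t\ge 0$, is valid: $\omega_0=s(A)$ is the smallest $\omega\in\mathbb{R}$ for which such an estimate holds with some $M\ge 1$, and $M_0=1$ is the smallest $M\ge 1$ for which it holds with $\omega=\omega_0$.
   Context: The norm of operators is the operator norm. $\sigma(A)$ denotes the spectrum of $A$, and $E_A(\cdot)$ is the (orthogonal projection-valued) spectral measure of the normal, possibly unbounded, operator $A$. The semigroup is $T(t)=e^{tA}=\int_{\sigma(A)}e^{t\lambda}\,dE_A(\lambda)$, $t\ge 0$. Spectral bound: $s(A):=\sup\{\operatorname{Re}\lambda : \lambda\in\sigma(A)\}$ ($-\infty$ if $\sigma(A)=\emptyset$). Growth bound: $\omega_0:=\inf\{\omega\in\mathbb{R} : \exists\, M=M(\omega)\ge 1 \text{ such that } \|T(t)\|\le Me^{\omega t} \text{ for all } t\ge 0\}$. *)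

theory Defs
  imports "HOL-Analysis.Analysis"
begin

text \<open>
  Complex Hilbert spaces, with an inner product that is linear in its first argument.  The real
  scalar multiplication, norm and completeness come from the library class for real Banach spaces.
\<close>

class complex_hilbert_space = banach +
  fixes scaleC :: "complex \<Rightarrow> 'a \<Rightarrow> 'a" (infixr "*\<^sub>C" 75)
    and cinner :: "'a \<Rightarrow> 'a \<Rightarrow> complex"
  assumes scaleC_add_right: "c *\<^sub>C (x + y) = c *\<^sub>C x + c *\<^sub>C y"
    and scaleC_add_left: "(c + d) *\<^sub>C x = c *\<^sub>C x + d *\<^sub>C x"
    and scaleC_scaleC: "c *\<^sub>C (d *\<^sub>C x) = (c * d) *\<^sub>C x"
    and scaleC_of_real: "complex_of_real r *\<^sub>C x = r *\<^sub>R x"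
    and cinner_commute: "cinner x y = cnj (cinner y x)"
    and cinner_add_left: "cinner (x + y) z = cinner x z + cinner y z"
    and cinner_scaleC_left: "cinner (c *\<^sub>C x) y = c * cinner x y"
    and cinner_ge_zero: "0 \<le> Re (cinner x x)"
    and cinner_eq_zero_iff: "cinner x x = 0 \<longleftrightarrow> x = 0"
    and norm_eq_sqrt_cinner: "norm x = sqrt (Re (cinner x x))"

definition bounded_clinear :: "('a::complex_hilbert_space \<Rightarrow> 'a) \<Rightarrow> bool" where
  "bounded_clinear f \<longleftrightarrow> bounded_linear f \<and> (\<forall>c x. f (c *\<^sub>C x) = c *\<^sub>C f x)"

text \<open>
  A possibly unbounded operator is represented by its graph, so that equality of operators includes
  equality of domains, \<^term>\<open>Domain A\<close> is the domain, and the product $BA$ with its natural domain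
  is the relational composition \<^term>\<open>A O B\<close> (note the order).
\<close>

definition op_graph :: "('a \<Rightarrow> 'a) \<Rightarrow> ('a \<times> 'a) set" where
  "op_graph f = range (\<lambda>x. (x, f x))"

definition linear_operator :: "('a::complex_hilbert_space \<times> 'a) set \<Rightarrow> bool" where
  "linear_operator A \<longleftrightarrow> single_valued A \<and> (0, 0) \<in> A \<and>
     (\<forall>x y x' y'. (x, y) \<in> A \<longrightarrow> (x', y') \<in> A \<longrightarrow> (x + x', y + y') \<in> A) \<and>
     (\<forall>c x y. (x, y) \<in> A \<longrightarrow> (c *\<^sub>C x, c *\<^sub>C y) \<in> A)"

definition adjoint_op :: "('a::complex_hilbert_space \<times> 'a) set \<Rightarrow> ('a \<times> 'a) set" where
  "adjoint_op A = {(y, z). \<forall>(x, w) \<in> A. cinner w y = cinner x z}"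

definition normal_operator :: "('a::complex_hilbert_space \<times> 'a) set \<Rightarrow> bool" where
  "normal_operator A \<longleftrightarrow> linear_operator A \<and> closure (Domain A) = UNIV \<and> closed A \<and>
     A O adjoint_op A = adjoint_op A O A"

text \<open>\<open>\<mu>\<close> is in the resolvent set iff $A - \mu I$ has an everywhere defined bounded inverse \<open>R\<close>.\<close>

definition op_spectrum :: "('a::complex_hilbert_space \<times> 'a) set \<Rightarrow> complex set" where
  "op_spectrum A =
     {\<mu>. \<not> (\<exists>R. bounded_clinear R \<and> {(y - \<mu> *\<^sub>C x, x) | x y. (x, y) \<in> A} = op_graph R)}"

text \<open>The value is \<open>-\<infinity>\<close> for an empty spectrum.\<close>

definition spectral_bound :: "('a::complex_hilbert_space \<times> 'a) set \<Rightarrow> ereal" where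
  "spectral_bound A = (SUP \<mu>\<in>op_spectrum A. ereal (Re \<mu>))"

definition orthogonal_projection :: "('a::complex_hilbert_space \<Rightarrow> 'a) \<Rightarrow> bool" where
  "orthogonal_projection P \<longleftrightarrow> bounded_clinear P \<and> (\<forall>x. P (P x) = P x) \<and>
     (\<forall>x y. cinner (P x) y = cinner x (P y))"

definition projection_valued_measure ::
    "(complex set \<Rightarrow> 'a::complex_hilbert_space \<Rightarrow> 'a) \<Rightarrow> bool" where
  "projection_valued_measure E \<longleftrightarrow>
     (\<forall>B\<in>sets borel. orthogonal_projection (E B)) \<and>
     (\<forall>x. E {} x = 0) \<and> (\<forall>x. E UNIV x = x) \<and>
     (\<forall>B\<in>sets borel. \<forall>C\<in>sets borel. \<forall>x. E (B \<inter> C) x = E B (E C x)) \<and>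
     (\<forall>B::nat \<Rightarrow> complex set. range B \<subseteq> sets borel \<longrightarrow> disjoint_family B \<longrightarrow>
        (\<forall>x. (\<lambda>n. E (B n) x) sums E (\<Union>n. B n) x))"

text \<open>The scalar measure $(E(\cdot)x,x)$.\<close>

definition scalar_measure ::
    "(complex set \<Rightarrow> 'a::complex_hilbert_space \<Rightarrow> 'a) \<Rightarrow> 'a \<Rightarrow> complex measure" where
  "scalar_measure E x = measure_of UNIV (sets borel) (\<lambda>B. ennreal (Re (cinner (E B x) x)))"

definition simple_spectral_integral ::
    "(complex set \<Rightarrow> 'a::complex_hilbert_space \<Rightarrow> 'a) \<Rightarrow> (complex \<Rightarrow> complex) \<Rightarrow> 'a \<Rightarrow> 'a" where
  "simple_spectral_integral E s x = (\<Sum>c\<in>range s. c *\<^sub>C E (s -` {c}) x)"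

text \<open>
  The operator $\int f\,dE$ for Borel measurable \<open>f\<close>: the integral of simple functions satisfies
  $\|\int s\,dE\,x\|^2 = \int |s|^2\,d(E(\cdot)x,x)$ and is extended by $L^2$-continuity.  Since simple
  functions are dense in $L^2$, the domain is $\{x.\ \int |f|^2\,d(E(\cdot)x,x) < \infty\}$.
\<close>

definition spectral_integral ::
    "(complex set \<Rightarrow> 'a::complex_hilbert_space \<Rightarrow> 'a) \<Rightarrow> (complex \<Rightarrow> complex) \<Rightarrow> ('a \<times> 'a) set" where
  "spectral_integral E f = {(x, y). \<exists>s::nat \<Rightarrow> complex \<Rightarrow> complex.
     (\<forall>n. simple_function borel (s n)) \<and>
     (\<lambda>n. \<integral>\<^sup>+z. ennreal ((norm (s n z - f z))\<^sup>2) \<partial>scalar_measure E x) \<longlonglongrightarrow> 0 \<and>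
     (\<lambda>n. simple_spectral_integral E (s n) x) \<longlonglongrightarrow> y}"

definition spectral_measure_of ::
    "('a::complex_hilbert_space \<times> 'a) set \<Rightarrow> (complex set \<Rightarrow> 'a \<Rightarrow> 'a) \<Rightarrow> bool" where
  "spectral_measure_of A E \<longleftrightarrow>
     projection_valued_measure E \<and> A = spectral_integral E (\<lambda>z. z)"

text \<open>In a semigroup \<open>T\<close> only the values \<open>T t\<close> for \<open>t \<ge> 0\<close> are meaningful.\<close>

definition C0_semigroup :: "(real \<Rightarrow> 'a::complex_hilbert_space \<Rightarrow> 'a) \<Rightarrow> bool" where
  "C0_semigroup T \<longleftrightarrow>
     (\<forall>t\<ge>0. bounded_clinear (T t)) \<and>
     (\<forall>x. T 0 x = x) \<and>
     (\<forall>s\<ge>0. \<forall>t\<ge>0. \<forall>x. T (s + t) x = T s (T t x)) \<and>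
     (\<forall>x. ((\<lambda>t. T t x) \<longlongrightarrow> x) (at_right 0))"

definition generator :: "(real \<Rightarrow> 'a::complex_hilbert_space \<Rightarrow> 'a) \<Rightarrow> ('a \<times> 'a) set" where
  "generator T = {(x, y). ((\<lambda>t. (T t x - x) /\<^sub>R t) \<longlongrightarrow> y) (at_right 0)}"

definition exp_bounded ::
    "(real \<Rightarrow> 'a::complex_hilbert_space \<Rightarrow> 'a) \<Rightarrow> real \<Rightarrow> real \<Rightarrow> bool" where
  "exp_bounded T M \<omega> \<longleftrightarrow> (\<forall>t\<ge>0. onorm (T t) \<le> M * exp (\<omega> * t))"

definition growth_bound :: "(real \<Rightarrow> 'a::complex_hilbert_space \<Rightarrow> 'a) \<Rightarrow> ereal" where
  "growth_bound T = (INF \<omega>\<in>{\<omega>. \<exists>M\<ge>1. exp_bounded T M \<omega>}. ereal \<omega>)"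

end

theory Submission
  imports Defs
begin

text \<open>
  Everything is read off from one growth estimate for the spectral components of an orbit, which
  takes the place of the formula \<open>T(t) = \<integral> e\<^sup>t\<^sup>z dE(z)\<close>.

  The projection \<open>E(B)\<close> maps the graph of \<open>A\<close> into itself, and on its range the numerical range of
  \<open>A\<close> is confined by \<open>B\<close>: if \<open>Re z \<ge> c\<close> on \<open>B\<close>, then \<open>Re (A u, u) \<ge> c \<parallel>u\<parallel>\<^sup>2\<close> for \<open>u\<close> in the domain of \<open>A\<close>
  with \<open>E(B)u = u\<close>, and likewise with \<open>\<le>\<close>.  For \<open>x\<close> in the domain the function
  \<open>\<parallel>E(B)T(t)x\<parallel>\<^sup>2\<close> has the derivative \<open>2 Re (A u, u)\<close> with \<open>u = E(B)T(t)x\<close>.  Two consequences are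

  \<^item> \<open>growth_of_component\<close>: if \<open>Re z \<ge> c\<close> on \<open>B\<close>, then \<open>\<parallel>E(B)T(t)x\<parallel> \<ge> e\<^sup>c\<^sup>t \<parallel>E(B)x\<parallel>\<close>.  So a bound
    \<open>\<parallel>T(t)\<parallel> < e\<^sup>c\<^sup>t\<close> at a single time \<open>t\<close> forces \<open>E\<close> to vanish on the half-plane \<open>Re z \<ge> c\<close>.

  \<^item> \<open>null_half_plane_imp_norm_bound\<close>: if \<open>E\<close> vanishes on \<open>Re z > c\<close>, then \<open>\<parallel>T(t)\<parallel> \<le> e\<^sup>c\<^sup>t\<close>, with
    constant 1.

  The link with the spectrum is \<open>E_null_if_disjoint_spectrum\<close> (\<open>E\<close> vanishes off the spectrum, in
  particular the spectrum is nonempty) and \<open>null_half_plane_imp_resolvent\<close> (if \<open>E\<close> vanishes on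
  \<open>Re z > c\<close>, that half-plane lies in the resolvent set).  Hence \<open>\<parallel>T(1)\<parallel> < \<infinity>\<close> bounds the spectral
  bound \<open>w\<close> from above, \<open>\<parallel>T(t)\<parallel> \<le> e\<^sup>w\<^sup>t\<close> follows, and an estimate \<open>\<parallel>T(t)\<parallel> \<le> M e\<^sup>v\<^sup>t\<close>, evaluated at a
  time at which \<open>e\<^sup>\<epsilon>\<^sup>t\<close> exceeds \<open>M\<close>, gives \<open>w \<le> v + \<epsilon>\<close>.

  Differentiability of the orbits from both sides uses that \<open>\<parallel>T(t)\<parallel>\<close> is bounded on bounded
  intervals, which is where the uniform boundedness principle enters.
\<close>

section \<open>Geometry of complex Hilbert spaces\<close>

lemma cinner_add_right: "cinner x (y + z) = cinner x y + cinner x z"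
  by (metis cinner_add_left cinner_commute complex_cnj_add)

lemma cinner_scaleC_right: "cinner x (c *\<^sub>C y) = cnj c * cinner x y"
  by (metis cinner_commute cinner_scaleC_left complex_cnj_mult)

lemma cinner_scaleR_left: "cinner (r *\<^sub>R x) y = r *\<^sub>R cinner x y"
  by (metis cinner_scaleC_left scaleC_of_real scaleR_conv_of_real)

lemma cinner_scaleR_right: "cinner x (r *\<^sub>R y) = r *\<^sub>R cinner x y"
  by (metis cinner_scaleC_right complex_cnj_complex_of_real scaleC_of_real scaleR_conv_of_real)

lemma cinner_zero_left [simp]: "cinner 0 y = 0"
  using cinner_scaleR_left[of 0 0 y] by simp

lemma cinner_zero_right [simp]: "cinner x 0 = 0"
  using cinner_scaleR_right[of x 0 0] by simp

lemma cinner_diff_left: "cinner (x - y) z = cinner x z - cinner y z"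
  using cinner_add_left[of "x - y" y z] by simp

lemma cinner_diff_right: "cinner x (y - z) = cinner x y - cinner x z"
  using cinner_add_right[of x "y - z" z] by simp

lemma cinner_sum_left: "cinner (sum f I) y = (\<Sum>i\<in>I. cinner (f i) y)"
  by (induction I rule: infinite_finite_induct) (auto simp: cinner_add_left)

lemma cinner_sum_right: "cinner x (sum f I) = (\<Sum>i\<in>I. cinner x (f i))"
  by (induction I rule: infinite_finite_induct) (auto simp: cinner_add_right)

lemma Re_cinner_same: "Re (cinner x x) = (norm x)\<^sup>2"
  by (simp add: norm_eq_sqrt_cinner cinner_ge_zero)

lemma cinner_same: "cinner x x = of_real ((norm x)\<^sup>2)"
proof (rule complex_eqI)
  have "Im (cinner x x) = - Im (cinner x x)"
    by (metis cinner_commute cnj.simps(2))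
  then show "Im (cinner x x) = Im (of_real ((norm x)\<^sup>2))" by simp
qed (simp add: Re_cinner_same)

lemma norm_scaleC: "norm (c *\<^sub>C x) = norm c * norm (x::'a::complex_hilbert_space)"
proof -
  have "cinner (c *\<^sub>C x) (c *\<^sub>C x) = (c * cnj c) * cinner x x"
    by (simp only: cinner_scaleC_left cinner_scaleC_right mult_ac)
  also have "\<dots> = of_real ((norm c * norm x)\<^sup>2)"
    by (simp only: cinner_same complex_norm_square[symmetric] of_real_mult power_mult_distrib)
  finally have "cinner (c *\<^sub>C x) (c *\<^sub>C x) = of_real ((norm c * norm x)\<^sup>2)" .
  then have "(norm (c *\<^sub>C x))\<^sup>2 = (norm c * norm x)\<^sup>2"
    by (metis Re_cinner_same Re_complex_of_real)
  then show ?thesis by (simp add: power2_eq_iff_nonneg)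
qed

lemma scaleC_zero_right [simp]: "c *\<^sub>C (0::'a::complex_hilbert_space) = 0"
  using scaleC_add_right[of c 0 0] by simp

lemma scaleC_minus1: "(- 1) *\<^sub>C x = - x"
  using scaleC_of_real[of "-1" x] by simp

lemma scaleC_diff_right: "c *\<^sub>C (x - y) = c *\<^sub>C x - c *\<^sub>C y"
  using scaleC_add_right[of c "x - y" y] by simp

lemma norm_diff_squared:
  "(norm (x - y))\<^sup>2 = (norm x)\<^sup>2 - 2 * Re (cinner x y) + (norm y)\<^sup>2"
proof -
  have "Re (cinner y x) = Re (cinner x y)" by (metis cinner_commute cnj.simps(1))
  then show ?thesis
    by (simp add: Re_cinner_same[symmetric] cinner_diff_left cinner_diff_right)
qed

text \<open>
  If subtracting multiples of \<open>u\<close> cannot shorten \<open>z\<close>, then \<open>z\<close> is orthogonal to \<open>u\<close>.  Both the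
  Cauchy--Schwarz inequality and the projection theorem come from this.
\<close>

lemma orthogonal_if_shortest:
  assumes "\<And>a. norm z \<le> norm (z - a *\<^sub>C u)"
  shows "cinner z u = 0"
proof -
  define k where "k = (norm (cinner z u))\<^sup>2"
  \<comment> \<open>Small enough for the first-order term in \<open>\<parallel>z - e (z,u) u\<parallel>\<^sup>2\<close> to outweigh the second-order one,
      also when \<open>u = 0\<close>.\<close>
  define e where "e = 1 / ((norm u)\<^sup>2 + 1)"
  have e: "e > 0" "e * (norm u)\<^sup>2 < 1"
    by (auto simp: e_def field_simps add_nonneg_pos add_pos_nonneg intro: add_nonneg_pos)
  have "(norm z)\<^sup>2 \<le> (norm (z - (e *\<^sub>R cinner z u) *\<^sub>C u))\<^sup>2"
    using assms by (intro power_mono) auto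
  also have "\<dots> = (norm z)\<^sup>2 - 2 * e * k + e\<^sup>2 * k * (norm u)\<^sup>2"
  proof -
    have "cinner z u * cnj (cinner z u) = of_real k"
      unfolding k_def by (rule complex_norm_square[symmetric])
    then have "cinner z ((e *\<^sub>R cinner z u) *\<^sub>C u) = of_real (e * k)"
      by (simp add: cinner_scaleC_right scaleR_conv_of_real mult.commute)
    then show ?thesis
      by (simp add: norm_diff_squared norm_scaleC power_mult_distrib k_def)
  qed
  finally have "e * (k * (2 - e * (norm u)\<^sup>2)) \<le> 0"
    by (simp add: algebra_simps power2_eq_square)
  moreover have "2 - e * (norm u)\<^sup>2 > 0" using e by simp
  ultimately have "k \<le> 0"
    using e by (meson linorder_not_le mult_pos_pos)
  then show ?thesis by (simp add: k_def)
qed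

lemma cinner_Cauchy_Schwarz: "norm (cinner x y) \<le> norm x * norm y"
proof (cases "y = 0")
  case False
  define a where "a = cinner x y / of_real ((norm y)\<^sup>2)"
  have "0 \<le> (norm (x - a *\<^sub>C y))\<^sup>2" by simp
  also have "\<dots> = (norm x)\<^sup>2 - (norm (cinner x y))\<^sup>2 / (norm y)\<^sup>2"
  proof -
    have "cinner x (a *\<^sub>C y) = of_real ((norm (cinner x y))\<^sup>2 / (norm y)\<^sup>2)"
      using complex_norm_square[of "cinner x y"]
      by (simp add: cinner_scaleC_right a_def mult.commute)
    moreover have "(norm (a *\<^sub>C y))\<^sup>2 = (norm (cinner x y))\<^sup>2 / (norm y)\<^sup>2"
      using False by (simp add: norm_scaleC a_def norm_divide norm_power norm_mult power2_eq_square)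
    ultimately show ?thesis by (simp add: norm_diff_squared)
  qed
  finally have "(norm (cinner x y))\<^sup>2 \<le> (norm x * norm y)\<^sup>2"
    using False by (simp add: field_simps power_mult_distrib)
  then show ?thesis by (simp add: power2_le_iff_abs_le)
qed simp

lemma bounded_bilinear_cinner: "bounded_bilinear cinner"
  by standard
    (auto simp: cinner_add_left cinner_add_right cinner_scaleR_left cinner_scaleR_right
      intro!: exI[of _ 1] cinner_Cauchy_Schwarz)

lemmas tendsto_cinner = bounded_bilinear.tendsto[OF bounded_bilinear_cinner]

lemma Re_cinner_le: "Re (cinner x y) \<le> norm x * norm y"
  using cinner_Cauchy_Schwarz[of x y] complex_Re_le_cmod[of "cinner x y"] by linarith

lemma parallelogram:
  "(norm (x + y))\<^sup>2 + (norm (x - y))\<^sup>2 = 2 * (norm x)\<^sup>2 + 2 * (norm (y::'a::complex_hilbert_space))\<^sup>2"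
  by (simp add: Re_cinner_same[symmetric] cinner_diff_left cinner_diff_right
      cinner_add_left cinner_add_right)

text \<open>
  For a point \<open>p\<close>, a minimizing sequence for the distance from \<open>p\<close> to \<open>S\<close> is Cauchy by the parallelogram
  law; its limit \<open>l\<close> is a point of \<open>S\<close> nearest to \<open>p\<close>, so \<open>p - l\<close> is orthogonal to \<open>S\<close> and therefore 0.
\<close>

lemma closed_subspace_eq_UNIV:
  fixes S :: "'a::complex_hilbert_space set"
  assumes closed: "closed S" and zero: "0 \<in> S"
    and add: "\<And>x y. x \<in> S \<Longrightarrow> y \<in> S \<Longrightarrow> x + y \<in> S"
    and scale: "\<And>c x. x \<in> S \<Longrightarrow> c *\<^sub>C x \<in> S"
    and orth: "\<And>z. (\<forall>x\<in>S. cinner z x = 0) \<Longrightarrow> z = 0"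
  shows "S = UNIV"
proof -
  have "p \<in> S" for p
  proof -
    define d where "d = infdist p S"
    have S: "S \<noteq> {}" using zero by auto
    have d_le: "d \<le> norm (p - s)" if "s \<in> S" for s
      using infdist_le[OF that, of p] by (simp add: d_def dist_norm)
    have "d \<ge> 0" by (simp add: d_def infdist_nonneg)
    have "\<exists>s\<in>S. norm (p - s) < d + 1 / Suc n" for n
    proof -
      have "infdist p S < d + 1 / Suc n" by (simp add: d_def)
      then show ?thesis
        using S by (subst (asm) infdist_notempty, simp, subst (asm) cINF_less_iff)
          (auto simp: dist_norm intro: bdd_belowI[of _ 0])
    qed
    then obtain s where s: "\<And>n. s n \<in> S" "\<And>n. norm (p - s n) < d + 1 / Suc n" by metis
    have lim: "(\<lambda>n. norm (p - s n)) \<longlonglongrightarrow> d"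
    proof (rule tendsto_sandwich[where f = "\<lambda>_. d" and h = "\<lambda>n. d + 1 / Suc n"])
      show "(\<lambda>n. d + 1 / Suc n) \<longlonglongrightarrow> d"
        using tendsto_add[OF tendsto_const[of d] LIMSEQ_inverse_real_of_nat]
        by (simp add: inverse_eq_divide)
      show "\<forall>\<^sub>F n in sequentially. d \<le> norm (p - s n)" using d_le s(1) by simp
      show "\<forall>\<^sub>F n in sequentially. norm (p - s n) \<le> d + 1 / Suc n"
        using s(2) by (intro always_eventually allI less_imp_le)
    qed (rule tendsto_const)
    have par: "(norm (s m - s n))\<^sup>2 \<le>
        2 * ((norm (p - s m))\<^sup>2 - d\<^sup>2) + 2 * ((norm (p - s n))\<^sup>2 - d\<^sup>2)" for m n
    proof -
      have mid: "(1/2) *\<^sub>R (s m + s n) \<in> S"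
        using scale[OF add[OF s(1)[of m] s(1)[of n]], of "of_real (1/2)"]
        by (simp only: scaleC_of_real)
      have "(p - s m) + (p - s n) = 2 *\<^sub>R (p - (1/2) *\<^sub>R (s m + s n))"
        by (simp add: scaleR_diff_right scaleR_2)
      then have "2 * d \<le> norm ((p - s m) + (p - s n))"
        using d_le[OF mid] by simp
      then have "(2 * d)\<^sup>2 \<le> (norm ((p - s m) + (p - s n)))\<^sup>2"
        using \<open>d \<ge> 0\<close> by (intro power_mono) auto
      then show ?thesis
        using parallelogram[of "p - s m" "p - s n"] by (simp add: norm_minus_commute)
    qed
    have "Cauchy s"
    proof (rule metric_CauchyI)
      fix e :: real assume "e > 0"
      have "(\<lambda>n. (norm (p - s n))\<^sup>2 - d\<^sup>2) \<longlonglongrightarrow> d\<^sup>2 - d\<^sup>2"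
        by (intro tendsto_intros lim)
      then have "\<forall>\<^sub>F n in sequentially. (norm (p - s n))\<^sup>2 - d\<^sup>2 < e\<^sup>2 / 4"
        using \<open>e > 0\<close> by (intro order_tendstoD(2)) auto
      then obtain N where N: "\<And>n. n \<ge> N \<Longrightarrow> (norm (p - s n))\<^sup>2 - d\<^sup>2 < e\<^sup>2 / 4"
        by (auto simp: eventually_sequentially)
      have "dist (s m) (s n) < e" if "m \<ge> N" "n \<ge> N" for m n
      proof -
        have "(norm (s m - s n))\<^sup>2 < e\<^sup>2"
          using par[of m n] N[OF that(1)] N[OF that(2)] by simp
        then show ?thesis using \<open>e > 0\<close> by (simp add: dist_norm power_less_imp_less_base)
      qed
      then show "\<exists>N. \<forall>m\<ge>N. \<forall>n\<ge>N. dist (s m) (s n) < e" by blast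
    qed
    then obtain l where l: "s \<longlonglongrightarrow> l" using Cauchy_convergent_iff convergent_def by blast
    have "l \<in> S" using closed_sequentially[OF closed _ l] s by blast
    have "norm (p - l) = d"
      using LIMSEQ_unique[OF lim tendsto_norm[OF tendsto_diff[OF tendsto_const l]]] by simp
    have "cinner (p - l) u = 0" if "u \<in> S" for u
    proof (rule orthogonal_if_shortest)
      fix a
      have "l + a *\<^sub>C u \<in> S" using \<open>l \<in> S\<close> that add scale by blast
      then show "norm (p - l) \<le> norm (p - l - a *\<^sub>C u)"
        using d_le \<open>norm (p - l) = d\<close> by (metis diff_diff_eq)
    qed
    then have "p - l = 0" using orth by blast
    then show ?thesis using \<open>l \<in> S\<close> by simp
  qed
  then show ?thesis by auto
qed

text \<open>The space is the union of the closed sets \<open>C k\<close> of points whose orbit stays within \<open>k\<close>.  By the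
  Baire category theorem one of them contains a ball, and linearity turns the bound on that ball into
  a bound on the operators.\<close>

lemma uniform_boundedness:
  fixes F :: "nat \<Rightarrow> 'a::banach \<Rightarrow> 'b::real_normed_vector"
  assumes lin: "\<And>n. bounded_linear (F n)" and bd: "\<And>x. bounded (range (\<lambda>n. F n x))"
  shows "\<exists>K. \<forall>n x. norm (F n x) \<le> K * norm x"
proof -
  define C where "C k = {x. \<forall>n. norm (F n x) \<le> real k}" for k
  have C: "C k = (\<Inter>n. {x. norm (F n x) \<le> real k})" for k by (auto simp: C_def)
  have cont: "continuous_on UNIV (\<lambda>x. norm (F n x))" for n
    using lin by (intro continuous_on_norm linear_continuous_on)
  have clC: "closed (C k)" for k unfolding C
    by (intro closed_INT ballI closed_Collect_le cont continuous_on_const)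
  have "x \<in> (\<Union>k. C k)" for x
  proof -
    obtain b where b: "\<And>n. norm (F n x) \<le> b" using bd[of x] unfolding bounded_iff by auto
    obtain k :: nat where "b \<le> real k" using real_arch_simple by blast
    then have "x \<in> C k" using b order_trans unfolding C_def by blast
    then show ?thesis by blast
  qed
  then have un: "\<Union>(range C) = UNIV" by blast
  have "\<exists>k. interior (C k) \<noteq> {}"
  proof (rule ccontr)
    assume "\<not> ?thesis"
    then have "interior (\<Union>(range C)) = {}"
      using Met_TC.metric_Baire_category_alt[of "range C"] clC
      by (auto simp: interior_of_eq complete_UNIV)
    then show False by (simp add: un)
  qed
  then obtain k a where "a \<in> interior (C k)" by blast
  then obtain r where r: "r > 0" "cball a r \<subseteq> C k" by (meson mem_interior_cball)
  have "norm (F n x) \<le> (2 * k / r) * norm x" for n x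
  proof (cases "x = 0")
    case False
    interpret bounded_linear "F n" by (rule lin)
    define h where "h = (r / norm x) *\<^sub>R x"
    have "a + h \<in> cball a r" "a \<in> cball a r" using r False by (auto simp: h_def dist_norm)
    then have "norm (F n (a + h)) \<le> k" "norm (F n a) \<le> k" using r(2) unfolding C_def by blast+
    moreover have "F n h = F n (a + h) - F n a" by (simp add: add)
    ultimately have "norm (F n h) \<le> 2 * k" using norm_triangle_ineq4[of "F n (a+h)" "F n a"] by simp
    moreover have "norm (F n h) = r / norm x * norm (F n x)" using r by (simp add: h_def scaleR)
    ultimately show ?thesis using r False by (simp add: field_simps)
  qed (simp add: bounded_linear.linear[OF lin] linear_0)
  then show ?thesis by blast
qed

section \<open>Integration against a projection-valued measure\<close>

locale pvm =
  fixes E :: "complex set \<Rightarrow> 'a::complex_hilbert_space \<Rightarrow> 'a"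
  assumes pvm: "projection_valued_measure E"
begin

lemma orthogonal_projection: "B \<in> sets borel \<Longrightarrow> orthogonal_projection (E B)"
  using pvm by (simp add: projection_valued_measure_def)

lemma bounded_linear_E: "B \<in> sets borel \<Longrightarrow> bounded_linear (E B)"
  using orthogonal_projection by (auto simp: orthogonal_projection_def bounded_clinear_def)

lemma E_scaleC: "B \<in> sets borel \<Longrightarrow> E B (c *\<^sub>C x) = c *\<^sub>C E B x"
  using orthogonal_projection by (auto simp: orthogonal_projection_def bounded_clinear_def)

lemma E_idem: "B \<in> sets borel \<Longrightarrow> E B (E B x) = E B x"
  using orthogonal_projection by (auto simp: orthogonal_projection_def)

lemma E_self_adjoint: "B \<in> sets borel \<Longrightarrow> cinner (E B x) y = cinner x (E B y)"
  using orthogonal_projection by (auto simp: orthogonal_projection_def)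

lemma E_empty: "E {} x = 0" and E_UNIV: "E UNIV x = x"
  using pvm by (auto simp: projection_valued_measure_def)

lemma E_Int: "B \<in> sets borel \<Longrightarrow> C \<in> sets borel \<Longrightarrow> E (B \<inter> C) x = E B (E C x)"
  using pvm by (auto simp: projection_valued_measure_def)

lemma E_sums:
  "range B \<subseteq> sets borel \<Longrightarrow> disjoint_family B \<Longrightarrow> (\<lambda>n::nat. E (B n) x) sums E (\<Union>n. B n) x"
  using pvm by (auto simp: projection_valued_measure_def)

lemma cinner_E:
  assumes "B \<in> sets borel"
  shows "cinner (E B x) x = of_real ((norm (E B x))\<^sup>2)"
  using E_self_adjoint[OF assms, of "E B x" x] by (simp add: E_idem[OF assms] cinner_same)

lemma norm_E_le: "B \<in> sets borel \<Longrightarrow> norm (E B x) \<le> norm x"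
  using cinner_Cauchy_Schwarz[of "E B x" x]
  by (cases "E B x = 0") (simp_all add: cinner_E power2_eq_square norm_mult)

lemma space_scalar_measure [simp]: "space (scalar_measure E x) = UNIV"
  by (simp add: scalar_measure_def)

lemma sets_scalar_measure [simp, measurable_cong]: "sets (scalar_measure E x) = sets borel"
  using sets.sigma_sets_eq[of "borel :: complex measure"] by (simp add: scalar_measure_def)

lemma emeasure_scalar_measure:
  assumes "B \<in> sets borel"
  shows "emeasure (scalar_measure E x) B = ennreal ((norm (E B x))\<^sup>2)"
proof -
  have "emeasure (scalar_measure E x) B = ennreal (Re (cinner (E B x) x))"
    unfolding scalar_measure_def
  proof (rule emeasure_measure_of_sigma)
    show "sigma_algebra UNIV (sets (borel :: complex measure))"
      using sets.sigma_algebra_axioms[of "borel :: complex measure"] by simp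
    show "positive (sets borel) (\<lambda>B. ennreal (Re (cinner (E B x) x)))"
      by (simp add: positive_def E_empty)
    show "countably_additive (sets borel) (\<lambda>B. ennreal (Re (cinner (E B x) x)))"
    proof (rule countably_additiveI)
      fix B :: "nat \<Rightarrow> complex set"
      assume B: "range B \<subseteq> sets borel" "disjoint_family B"
      have "(\<lambda>n. Re (cinner (E (B n) x) x)) sums Re (cinner (E (\<Union>n. B n) x) x)"
        by (intro bounded_linear.sums[OF bounded_linear_Re]
            bounded_linear.sums[OF bounded_bilinear.bounded_linear_left[OF bounded_bilinear_cinner]]
            E_sums B)
      then show "(\<Sum>n. ennreal (Re (cinner (E (B n) x) x))) = ennreal (Re (cinner (E (\<Union>n. B n) x) x))"
        using B by (intro suminf_ennreal_eq) (auto simp: cinner_E)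
    qed
  qed fact
  then show ?thesis by (simp add: cinner_E assms)
qed

lemma finite_scalar_measure: "finite_measure (scalar_measure E x)"
  by (rule finite_measureI) (simp add: emeasure_scalar_measure)

lemma measure_scalar_measure:
  "B \<in> sets borel \<Longrightarrow> measure (scalar_measure E x) B = (norm (E B x))\<^sup>2"
  by (simp add: measure_def emeasure_scalar_measure)

text \<open>Whether \<open>E(B)x\<close> vanishes is thus a question about one finite measure, so that countable unions
  and concentration on a set are handled by ordinary measure theory.\<close>

lemma null_sets_scalar_measure:
  "B \<in> sets borel \<Longrightarrow> B \<in> null_sets (scalar_measure E x) \<longleftrightarrow> E B x = 0"
  by (auto simp: null_sets_def emeasure_scalar_measure)

lemma E_countable_Union_eq_0:
  assumes "countable \<B>" "\<And>B. B \<in> \<B> \<Longrightarrow> B \<in> sets borel" "\<And>B. B \<in> \<B> \<Longrightarrow> E B x = 0"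
  shows "E (\<Union>\<B>) x = 0"
proof -
  have "(\<Union>B\<in>\<B>. B) \<in> null_sets (scalar_measure E x)"
    using assms by (intro null_sets_UN') (auto simp: null_sets_scalar_measure)
  moreover have "\<Union>\<B> \<in> sets borel" using assms by (intro sets.countable_Union) auto
  ultimately show ?thesis by (simp add: null_sets_scalar_measure)
qed

lemma E_null_subset:
  assumes "B \<subseteq> C" "B \<in> sets borel" "C \<in> sets borel" "E C x = 0"
  shows "E B x = 0"
  using E_Int[OF assms(2,3), of x] assms bounded_linear.linear[OF bounded_linear_E, of B]
  by (simp add: Int_absorb2 linear_0)

lemma AE_in_if_E_fixes:
  assumes B: "B \<in> sets borel" and x: "E B x = x"
  shows "AE z in scalar_measure E x. z \<in> B"
proof (rule AE_I')
  have "E (- B) x = E (- B \<inter> B) x" using E_Int[of "- B" B x] B x by simp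
  then show "- B \<in> null_sets (scalar_measure E x)"
    using B by (simp add: null_sets_scalar_measure E_empty)
qed auto

lemma
  assumes "simple_function borel (s :: complex \<Rightarrow> complex)"
  shows finite_range_simple: "finite (range s)" and vimage_simple: "s -` C \<in> sets borel"
  using simple_functionD[OF assms] by auto

lemma integral_compose_simple:
  fixes h :: "complex \<Rightarrow> real"
  assumes s: "simple_function borel s"
  shows "(\<integral>z. h (s z) \<partial>scalar_measure E x) =
    (\<Sum>c\<in>range s. h c * (norm (E (s -` {c}) x))\<^sup>2)"
    and "integrable (scalar_measure E x) (\<lambda>z. h (s z))"
proof -
  interpret finite_measure "scalar_measure E x" by (rule finite_scalar_measure)
  note s' = finite_range_simple[OF s] vimage_simple[OF s]
  have eq: "h (s z) = (\<Sum>c\<in>range s. h c * indicator (s -` {c}) z)" for z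
  proof -
    have "(\<Sum>c\<in>range s. h c * indicator (s -` {c}) z) = (\<Sum>c\<in>range s. if s z = c then h c else 0)"
      by (intro sum.cong) (auto simp: indicator_def)
    then show ?thesis using s' by (simp add: sum.delta')
  qed
  have int: "integrable (scalar_measure E x) (\<lambda>z. h c * indicator (s -` {c}) z)" for c
    using s' by (intro integrable_mult_right integrable_real_indicator) (auto simp: less_top[symmetric])
  show "integrable (scalar_measure E x) (\<lambda>z. h (s z))"
    unfolding eq by (intro Bochner_Integration.integrable_sum int)
  show "(\<integral>z. h (s z) \<partial>scalar_measure E x) =
    (\<Sum>c\<in>range s. h c * (norm (E (s -` {c}) x))\<^sup>2)"
    unfolding eq using s' int
    by (subst Bochner_Integration.integral_sum) (auto simp: measure_scalar_measure)
qed

lemma E_simple_integral: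
  assumes "simple_function borel s" "B \<in> sets borel"
  shows "E B (simple_spectral_integral E s x) = simple_spectral_integral E s (E B x)"
proof -
  have "E B (E (s -` {c}) x) = E (s -` {c}) (E B x)" for c
    using E_Int[of B "s -` {c}" x] E_Int[of "s -` {c}" B x] assms vimage_simple
    by (simp add: Int_commute)
  then show ?thesis
    using assms bounded_linear.linear[OF bounded_linear_E]
    by (simp add: simple_spectral_integral_def linear_sum E_scaleC)
qed

lemma cinner_simple_integral:
  assumes s: "simple_function borel s"
  shows "cinner (simple_spectral_integral E s x) x =
    (\<Sum>c\<in>range s. c * of_real ((norm (E (s -` {c}) x))\<^sup>2))"
  using vimage_simple[OF s]
  by (simp add: simple_spectral_integral_def cinner_sum_left cinner_scaleC_left cinner_E)

text \<open>The components of \<open>x\<close> on different level sets of \<open>s\<close> are orthogonal.\<close>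

lemma norm_simple_integral:
  assumes s: "simple_function borel s"
  shows "(norm (simple_spectral_integral E s x))\<^sup>2 =
    (\<Sum>c\<in>range s. (norm c)\<^sup>2 * (norm (E (s -` {c}) x))\<^sup>2)"
proof -
  note s' = finite_range_simple[OF s] vimage_simple[OF s]
  have "cinner (E (s -` {c}) x) (E (s -` {d}) x) =
      (if c = d then of_real ((norm (E (s -` {c}) x))\<^sup>2) else 0)" for c d
  proof (cases "c = d")
    case False
    then have "s -` {c} \<inter> s -` {d} = {}" by auto
    then show ?thesis
      using False s' E_Int[of "s -` {c}" "s -` {d}" x] E_self_adjoint[of "s -` {c}" x "E (s -` {d}) x"]
      by (simp add: E_empty)
  qed (simp add: cinner_same)
  then have "cinner (simple_spectral_integral E s x) (simple_spectral_integral E s x) =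
      (\<Sum>c\<in>range s. c * cnj c * of_real ((norm (E (s -` {c}) x))\<^sup>2))"
    using s' by (simp add: simple_spectral_integral_def cinner_sum_left cinner_sum_right
        cinner_scaleC_left cinner_scaleC_right if_distrib[of "\<lambda>u. _ * u"] sum.delta cong: if_cong)
      (simp add: mult_ac)
  also have "\<dots> = of_real (\<Sum>c\<in>range s. (norm c)\<^sup>2 * (norm (E (s -` {c}) x))\<^sup>2)"
    by (simp only: of_real_sum of_real_mult complex_norm_square)
  finally show ?thesis by (metis Re_cinner_same Re_complex_of_real)
qed

lemma norm_simple_integral_diff:
  assumes s: "simple_function borel s"
  shows "(norm (simple_spectral_integral E s x - l *\<^sub>C x))\<^sup>2 =
    (\<integral>z. (norm (s z - l))\<^sup>2 \<partial>scalar_measure E x)"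
proof -
  define m where "m c = (norm (E (s -` {c}) x))\<^sup>2" for c
  note int = integral_compose_simple[OF s, where x = x, folded m_def]
  have "(\<integral>z. 1 \<partial>scalar_measure E x) = (norm x)\<^sup>2"
    using measure_scalar_measure[of UNIV x] by (simp add: E_UNIV)
  then have total: "(\<Sum>c\<in>range s. m c) = (norm x)\<^sup>2"
    using int(1)[where h = "\<lambda>_. 1"] by simp
  have expand: "(norm (c - l))\<^sup>2 = (norm c)\<^sup>2 - 2 * Re (c * cnj l) + (norm l)\<^sup>2" for c
    unfolding cmod_power2 by (simp add: power2_eq_square algebra_simps)
  have "(\<integral>z. (norm (s z - l))\<^sup>2 \<partial>scalar_measure E x) = (\<Sum>c\<in>range s. (norm (c - l))\<^sup>2 * m c)"
    by (rule int)
  also have "\<dots> = (\<Sum>c\<in>range s. (norm c)\<^sup>2 * m c) - 2 * (\<Sum>c\<in>range s. Re (c * cnj l) * m c)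
      + (norm l)\<^sup>2 * (norm x)\<^sup>2"
    unfolding expand total[symmetric]
    by (simp add: sum.distrib sum_subtractf sum_distrib_left algebra_simps del: times_complex.sel)
      (simp add: sum_distrib_right)
  also have "(\<Sum>c\<in>range s. Re (c * cnj l) * m c) = Re (cinner (simple_spectral_integral E s x) (l *\<^sub>C x))"
  proof -
    have "cinner (simple_spectral_integral E s x) (l *\<^sub>C x) = (\<Sum>c\<in>range s. (c * cnj l) * of_real (m c))"
      by (simp add: cinner_scaleC_right cinner_simple_integral[OF s] m_def sum_distrib_left mult_ac)
    moreover have "Re (a * of_real r) = Re a * r" for a r by simp
    ultimately show ?thesis by (simp only: Re_sum)
  qed
  finally show ?thesis
    by (simp add: norm_diff_squared norm_simple_integral[OF s] m_def norm_scaleC power_mult_distrib)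
qed

lemma Re_cinner_simple_integral:
  assumes s: "simple_function borel s"
  shows "Re (k * cinner (simple_spectral_integral E s x) x) = (\<integral>z. Re (k * s z) \<partial>scalar_measure E x)"
proof -
  have "Re (k * (c * of_real r)) = Re (k * c) * r" for c r by (simp add: algebra_simps)
  then show ?thesis
    unfolding integral_compose_simple(1)[OF s, where h = "\<lambda>c. Re (k * c)"] cinner_simple_integral[OF s]
    by (simp only: sum_distrib_left Re_sum)
qed

end

lemma le_if_le_add_epsilon:
  fixes a b k :: real
  assumes "\<And>e. e > 0 \<Longrightarrow> a \<le> b + e * k"
  shows "a \<le> b"
proof (rule field_le_epsilon)
  fix e :: real assume e: "e > 0"
  have "a \<le> b + e / (\<bar>k\<bar> + 1) * k" using e by (intro assms) simp
  also have "e / (\<bar>k\<bar> + 1) * k \<le> e / (\<bar>k\<bar> + 1) * (\<bar>k\<bar> + 1)"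
    using e by (intro mult_left_mono) auto
  finally show "a \<le> b + e" by simp
qed

lemma le_eps_add_square:
  fixes d e :: real
  assumes "e > 0"
  shows "d \<le> e + 1 / (4 * e) * d\<^sup>2"
proof -
  have "0 \<le> (d - 2 * e)\<^sup>2" by simp
  then have "4 * e * d \<le> 4 * e * e + d\<^sup>2" by (simp add: power2_eq_square algebra_simps)
  then show ?thesis using assms by (simp add: field_simps power2_eq_square)
qed

lemma square_add_le:
  fixes a d e :: real
  assumes "e > 0"
  shows "(a + d)\<^sup>2 \<le> (1 + e) * a\<^sup>2 + (1 + 1 / e) * d\<^sup>2"
proof -
  have "0 \<le> (e * a - d)\<^sup>2 / e" using assms by simp
  also have "\<dots> = e * a\<^sup>2 - 2 * a * d + d\<^sup>2 / e"
    using assms by (simp add: power2_eq_square field_simps)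
  finally show ?thesis by (simp add: power2_eq_square algebra_simps)
qed

context pvm
begin

text \<open>Because \<open>\<parallel>E(C)E(B)x\<parallel> \<le> \<parallel>E(C)x\<parallel>\<close>, simple functions that approximate \<open>f\<close> for \<open>x\<close> also approximate it
  for \<open>E(B)x\<close>.\<close>

lemma spectral_integral_E:
  assumes "(x, y) \<in> spectral_integral E f" and B: "B \<in> sets borel"
  shows "(E B x, E B y) \<in> spectral_integral E f"
proof -
  obtain s where s: "\<And>n. simple_function borel (s n)"
      "(\<lambda>n. \<integral>\<^sup>+z. ennreal ((norm (s n z - f z))\<^sup>2) \<partial>scalar_measure E x) \<longlonglongrightarrow> 0"
      "(\<lambda>n. simple_spectral_integral E (s n) x) \<longlonglongrightarrow> y"
    using assms(1) by (auto simp: spectral_integral_def)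
  have "norm (E C (E B x)) \<le> norm (E C x)" if "C \<in> sets borel" for C
  proof -
    have "E C (E B x) = E B (E C x)" using E_Int[OF that B] E_Int[OF B that] by (simp add: Int_commute)
    then show ?thesis by (simp add: norm_E_le B)
  qed
  then have le: "scalar_measure E (E B x) \<le> scalar_measure E x"
    by (subst le_measure) (auto simp: emeasure_scalar_measure intro!: ennreal_leI power_mono)
  have "(\<lambda>n. \<integral>\<^sup>+z. ennreal ((norm (s n z - f z))\<^sup>2) \<partial>scalar_measure E (E B x)) \<longlonglongrightarrow> 0"
    by (rule tendsto_sandwich[OF _ _ tendsto_const s(2)])
      (auto intro!: always_eventually nn_integral_mono_measure le)
  moreover have "(\<lambda>n. simple_spectral_integral E (s n) (E B x)) \<longlonglongrightarrow> E B y"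
    using bounded_linear.tendsto[OF bounded_linear_E[OF B] s(3)] by (simp add: E_simple_integral s(1) B)
  ultimately show ?thesis using s(1) unfolding spectral_integral_def by blast
qed

text \<open>The defining limit with ordinary integrals: only finitely many of the approximants can be at
  infinite distance, and these are dropped.\<close>

lemma spectral_integral_approximation:
  assumes "(x, y) \<in> spectral_integral E (\<lambda>z. z)"
  obtains s where "\<And>n::nat. simple_function borel (s n)"
    "\<And>n. integrable (scalar_measure E x) (\<lambda>z. (norm (s n z - z))\<^sup>2)"
    "(\<lambda>n. \<integral>z. (norm (s n z - z))\<^sup>2 \<partial>scalar_measure E x) \<longlonglongrightarrow> 0"
    "(\<lambda>n. simple_spectral_integral E (s n) x) \<longlonglongrightarrow> y"
proof -
  let ?M = "scalar_measure E x"
  obtain s where s: "\<And>n. simple_function borel (s n)"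
      "(\<lambda>n. \<integral>\<^sup>+z. ennreal ((norm (s n z - z))\<^sup>2) \<partial>?M) \<longlonglongrightarrow> 0"
      "(\<lambda>n. simple_spectral_integral E (s n) x) \<longlonglongrightarrow> y"
    using assms by (auto simp: spectral_integral_def)
  have [measurable]: "s n \<in> borel_measurable borel" for n
    using s(1) by (rule borel_measurable_simple_function)
  have meas: "(\<lambda>z. (norm (s n z - z))\<^sup>2) \<in> borel_measurable ?M" for n
    by measurable
  have "\<forall>\<^sub>F n in sequentially. (\<integral>\<^sup>+z. ennreal ((norm (s n z - z))\<^sup>2) \<partial>?M) < \<infinity>"
    using s(2) by (rule order_tendstoD(2)) simp
  then obtain N where N: "\<And>n. n \<ge> N \<Longrightarrow> (\<integral>\<^sup>+z. ennreal ((norm (s n z - z))\<^sup>2) \<partial>?M) < \<infinity>"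
    by (auto simp: eventually_sequentially)
  have "(\<lambda>n. enn2real (\<integral>\<^sup>+z. ennreal ((norm (s n z - z))\<^sup>2) \<partial>?M)) \<longlonglongrightarrow> 0"
    using s(2) by (intro tendsto_enn2real) simp_all
  then have "(\<lambda>n. \<integral>z. (norm (s n z - z))\<^sup>2 \<partial>?M) \<longlonglongrightarrow> 0"
    by (simp add: integral_eq_nn_integral[OF meas])
  from LIMSEQ_ignore_initial_segment[OF this, of N] LIMSEQ_ignore_initial_segment[OF s(3), of N]
  show ?thesis
    using s(1) N meas by (intro that[of "\<lambda>n. s (n + N)"]) (auto intro!: integrableI_nonneg)
qed

text \<open>
  The numerical range and the norm of \<open>\<integral> z dE\<close> at \<open>x\<close> are controlled by the set on which the scalar
  measure of \<open>x\<close> is concentrated.  Pointwise, the error made by a simple approximant is bounded by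
  an arbitrarily small constant plus a multiple of the squared error, which tends to 0 in the mean.
  The unimodular factor \<open>k\<close> below serves for upper bounds of the real part (\<open>k = 1\<close>) and for lower
  ones (\<open>k = -1\<close>).
\<close>

lemma Re_spectral_integral_le:
  assumes xy: "(x, y) \<in> spectral_integral E (\<lambda>z. z)" and k: "norm k = 1"
    and B: "B \<in> sets borel" "E B x = x" "\<And>z. z \<in> B \<Longrightarrow> Re (k * z) \<le> c"
  shows "Re (k * cinner y x) \<le> c * (norm x)\<^sup>2"
proof (rule le_if_le_add_epsilon)
  fix e :: real assume e: "e > 0"
  let ?M = "scalar_measure E x"
  interpret finite_measure ?M by (rule finite_scalar_measure)
  obtain s where s: "\<And>n::nat. simple_function borel (s n)"
    "\<And>n. integrable ?M (\<lambda>z. (norm (s n z - z))\<^sup>2)"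
    "(\<lambda>n. \<integral>z. (norm (s n z - z))\<^sup>2 \<partial>?M) \<longlonglongrightarrow> 0"
    "(\<lambda>n. simple_spectral_integral E (s n) x) \<longlonglongrightarrow> y"
    using spectral_integral_approximation[OF xy] by blast
  have total: "measure ?M UNIV = (norm x)\<^sup>2" by (simp add: measure_scalar_measure E_UNIV)
  have "Re (k * cinner (simple_spectral_integral E (s n) x) x)
      \<le> (c + e) * (norm x)\<^sup>2 + 1 / (4 * e) * (\<integral>z. (norm (s n z - z))\<^sup>2 \<partial>?M)" for n
  proof -
    have "Re (k * cinner (simple_spectral_integral E (s n) x) x) = (\<integral>z. Re (k * s n z) \<partial>?M)"
      by (rule Re_cinner_simple_integral[OF s(1)])
    also have "\<dots> \<le> (\<integral>z. (c + e) + 1 / (4 * e) * (norm (s n z - z))\<^sup>2 \<partial>?M)"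
    proof (rule integral_mono_AE)
      show "integrable ?M (\<lambda>z. Re (k * s n z))"
        by (rule integral_compose_simple(2)[OF s(1), where h = "\<lambda>w. Re (k * w)"])
      show "AE z in ?M. Re (k * s n z) \<le> (c + e) + 1 / (4 * e) * (norm (s n z - z))\<^sup>2"
        using AE_in_if_E_fixes[OF B(1,2)]
      proof eventually_elim
        case (elim z)
        have "Re (k * s n z) = Re (k * z) + Re (k * (s n z - z))" by (simp add: algebra_simps)
        also have "Re (k * (s n z - z)) \<le> norm (s n z - z)"
          using complex_Re_le_cmod[of "k * (s n z - z)"] k by (simp only: norm_mult mult_1)
        also have "\<dots> \<le> e + 1 / (4 * e) * (norm (s n z - z))\<^sup>2" by (rule le_eps_add_square[OF e])
        finally show ?case using B(3)[OF elim] by linarith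
      qed
    qed (use s(2) in auto)
    also have "\<dots> = (c + e) * (norm x)\<^sup>2 + 1 / (4 * e) * (\<integral>z. (norm (s n z - z))\<^sup>2 \<partial>?M)"
      using s(2) by (subst Bochner_Integration.integral_add) (auto simp: total)
    finally show ?thesis .
  qed
  moreover have "(\<lambda>n. Re (k * cinner (simple_spectral_integral E (s n) x) x)) \<longlonglongrightarrow> Re (k * cinner y x)"
    by (intro tendsto_intros tendsto_cinner s)
  moreover have "(\<lambda>n. (c + e) * (norm x)\<^sup>2 + 1 / (4 * e) * (\<integral>z. (norm (s n z - z))\<^sup>2 \<partial>?M))
      \<longlonglongrightarrow> (c + e) * (norm x)\<^sup>2 + 1 / (4 * e) * 0"
    by (intro tendsto_intros s)
  ultimately have "Re (k * cinner y x) \<le> (c + e) * (norm x)\<^sup>2 + 1 / (4 * e) * 0"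
    by (intro LIMSEQ_le) auto
  then show "Re (k * cinner y x) \<le> c * (norm x)\<^sup>2 + e * (norm x)\<^sup>2" by (simp add: algebra_simps)
qed

lemma norm_spectral_integral_diff_le:
  assumes xy: "(x, y) \<in> spectral_integral E (\<lambda>z. z)" and r: "r \<ge> 0"
    and B: "B \<in> sets borel" "E B x = x" "\<And>z. z \<in> B \<Longrightarrow> norm (z - l) \<le> r"
  shows "norm (y - l *\<^sub>C x) \<le> r * norm x"
proof -
  let ?M = "scalar_measure E x"
  interpret finite_measure ?M by (rule finite_scalar_measure)
  obtain s where s: "\<And>n::nat. simple_function borel (s n)"
    "\<And>n. integrable ?M (\<lambda>z. (norm (s n z - z))\<^sup>2)"
    "(\<lambda>n. \<integral>z. (norm (s n z - z))\<^sup>2 \<partial>?M) \<longlonglongrightarrow> 0"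
    "(\<lambda>n. simple_spectral_integral E (s n) x) \<longlonglongrightarrow> y"
    using spectral_integral_approximation[OF xy] by blast
  have total: "measure ?M UNIV = (norm x)\<^sup>2" by (simp add: measure_scalar_measure E_UNIV)
  have "(norm (y - l *\<^sub>C x))\<^sup>2 \<le> (r * norm x)\<^sup>2"
  proof (rule le_if_le_add_epsilon)
    fix e :: real assume e: "e > 0"
    have "(norm (simple_spectral_integral E (s n) x - l *\<^sub>C x))\<^sup>2
        \<le> (1 + e) * r\<^sup>2 * (norm x)\<^sup>2 + (1 + 1 / e) * (\<integral>z. (norm (s n z - z))\<^sup>2 \<partial>?M)" for n
    proof -
      have "(norm (simple_spectral_integral E (s n) x - l *\<^sub>C x))\<^sup>2 = (\<integral>z. (norm (s n z - l))\<^sup>2 \<partial>?M)"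
        by (rule norm_simple_integral_diff[OF s(1)])
      also have "\<dots> \<le> (\<integral>z. (1 + e) * r\<^sup>2 + (1 + 1 / e) * (norm (s n z - z))\<^sup>2 \<partial>?M)"
      proof (rule integral_mono_AE)
        show "integrable ?M (\<lambda>z. (norm (s n z - l))\<^sup>2)"
          by (rule integral_compose_simple(2)[OF s(1), where h = "\<lambda>w. (norm (w - l))\<^sup>2"])
        show "AE z in ?M. (norm (s n z - l))\<^sup>2 \<le> (1 + e) * r\<^sup>2 + (1 + 1 / e) * (norm (s n z - z))\<^sup>2"
          using AE_in_if_E_fixes[OF B(1,2)]
        proof eventually_elim
          case (elim z)
          have "norm (s n z - l) \<le> r + norm (s n z - z)"
            using norm_triangle_ineq[of "z - l" "s n z - z"] B(3)[OF elim] by simp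
          then have "(norm (s n z - l))\<^sup>2 \<le> (r + norm (s n z - z))\<^sup>2" by (intro power_mono) auto
          also note square_add_le[OF e]
          finally show ?case .
        qed
      qed (use s(2) in auto)
      also have "\<dots> = (1 + e) * r\<^sup>2 * (norm x)\<^sup>2 + (1 + 1 / e) * (\<integral>z. (norm (s n z - z))\<^sup>2 \<partial>?M)"
        using s(2) by (subst Bochner_Integration.integral_add) (auto simp: total)
      finally show ?thesis .
    qed
    moreover have "(\<lambda>n. (norm (simple_spectral_integral E (s n) x - l *\<^sub>C x))\<^sup>2)
        \<longlonglongrightarrow> (norm (y - l *\<^sub>C x))\<^sup>2"
      by (intro tendsto_intros s)
    moreover have "(\<lambda>n. (1 + e) * r\<^sup>2 * (norm x)\<^sup>2 + (1 + 1 / e) * (\<integral>z. (norm (s n z - z))\<^sup>2 \<partial>?M))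
        \<longlonglongrightarrow> (1 + e) * r\<^sup>2 * (norm x)\<^sup>2 + (1 + 1 / e) * 0"
      by (intro tendsto_intros s)
    ultimately have "(norm (y - l *\<^sub>C x))\<^sup>2 \<le> (1 + e) * r\<^sup>2 * (norm x)\<^sup>2 + (1 + 1 / e) * 0"
      by (intro LIMSEQ_le) auto
    then show "(norm (y - l *\<^sub>C x))\<^sup>2 \<le> (r * norm x)\<^sup>2 + e * (r * norm x)\<^sup>2"
      by (simp add: algebra_simps)
  qed
  then show ?thesis using r by (simp add: power2_le_iff_abs_le)
qed

end

section \<open>Spectral measure and spectrum\<close>

locale resolved_operator = pvm E for E :: "complex set \<Rightarrow> 'a::complex_hilbert_space \<Rightarrow> 'a" +
  fixes A :: "('a \<times> 'a) set"
  assumes linear_A: "linear_operator A"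
    and closed_A: "closed A"
    and dense_A: "closure (Domain A) = UNIV"
    and A_eq: "A = spectral_integral E (\<lambda>z. z)"
begin

lemma A_diff: "(x, y) \<in> A \<Longrightarrow> (x', y') \<in> A \<Longrightarrow> (x - x', y - y') \<in> A"
  using linear_A unfolding linear_operator_def
  by (metis add_uminus_conv_diff scaleC_minus1)

lemma dense_induct:
  assumes "closed {x. P x}" "\<And>x y. (x, y) \<in> A \<Longrightarrow> P x"
  shows "P x"
proof -
  have "closure (Domain A) \<subseteq> {x. P x}" using assms by (intro closure_minimal) auto
  then show ?thesis by (auto simp: dense_A)
qed

lemma E_eq_0_if_on_domain:
  assumes B: "B \<in> sets borel" and "\<And>x y. (x, y) \<in> A \<Longrightarrow> E B x = 0"
  shows "E B x = 0"
proof (rule dense_induct[where P = "\<lambda>x. E B x = 0"])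
  show "closed {x. E B x = 0}"
    by (intro closed_Collect_eq continuous_on_const linear_continuous_on bounded_linear_E B)
qed (use assms in auto)

text \<open>Near a resolvent point \<open>l\<close> the inverse of \<open>A - l\<close> is bounded, whereas \<open>A - l\<close> is small on the
  spectral subspace of a small disc around \<open>l\<close>; so that subspace vanishes.\<close>

lemma resolvent_imp_null_ball:
  assumes "l \<notin> op_spectrum A"
  obtains r where "r > 0" "\<And>x. E (ball l r) x = 0"
proof -
  obtain R where R: "bounded_clinear R" "{(y - l *\<^sub>C x, x) | x y. (x, y) \<in> A} = op_graph R"
    using assms by (auto simp: op_spectrum_def)
  obtain K where K: "K > 0" "\<And>u. norm (R u) \<le> norm u * K"
    using R(1) bounded_linear.pos_bounded unfolding bounded_clinear_def by blast
  \<comment> \<open>Any radius below \<open>1 / K\<close> would do.\<close>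
  define r where "r = 1 / (2 * K)"
  define B where "B = ball l r"
  have B: "B \<in> sets borel" by (simp add: B_def)
  have r: "r > 0" using K by (simp add: r_def)
  have "E B x = 0" if "(x, y) \<in> A" for x y
  proof -
    have uv: "(E B x, E B y) \<in> A"
      using spectral_integral_E[OF _ B] that A_eq by blast
    then have "(E B y - l *\<^sub>C E B x, E B x) \<in> op_graph R" using R(2) by blast
    then have "R (E B y - l *\<^sub>C E B x) = E B x" by (auto simp: op_graph_def)
    then have "norm (E B x) \<le> norm (E B y - l *\<^sub>C E B x) * K"
      using K(2)[of "E B y - l *\<^sub>C E B x"] by simp
    also have "\<dots> \<le> (r * norm (E B x)) * K"
      using K r uv A_eq
      by (intro mult_right_mono norm_spectral_integral_diff_le[OF _ _ B E_idem[OF B]])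
        (auto simp: B_def dist_norm norm_minus_commute)
    also have "\<dots> = norm (E B x) / 2" using K by (simp add: r_def)
    finally show ?thesis by simp
  qed
  then have "E B x = 0" for x by (rule E_eq_0_if_on_domain[OF B])
  with r show ?thesis using that B_def by blast
qed

text \<open>The resolvent set is covered by null balls, and countably many of them suffice by Lindelof's
  theorem.\<close>

lemma E_null_if_disjoint_spectrum:
  assumes "U \<in> sets borel" "U \<inter> op_spectrum A = {}"
  shows "E U x = 0"
proof -
  define F where "F = {ball l r | l r. \<forall>x. E (ball l r) x = 0}"
  obtain F' where F': "F' \<subseteq> F" "countable F'" "\<Union>F' = \<Union>F"
    using Lindelof[of F] by (auto simp: F_def)
  have "E (\<Union>F') x = 0"
    using F' by (intro E_countable_Union_eq_0) (auto simp: F_def)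
  moreover have "U \<subseteq> \<Union>F'"
  proof
    fix l assume "l \<in> U"
    then have "l \<notin> op_spectrum A" using assms by blast
    then obtain r where "r > 0" "\<And>x. E (ball l r) x = 0" using resolvent_imp_null_ball by blast
    then have "l \<in> ball l r" "ball l r \<in> F" by (auto simp: F_def)
    then show "l \<in> \<Union>F'" using F' by blast
  qed
  moreover have "\<Union>F' \<in> sets borel" using F' by (intro sets.countable_Union) (auto simp: F_def)
  ultimately show ?thesis using assms E_null_subset by blast
qed

lemma spectrum_nonempty:
  assumes "(x::'a) \<noteq> 0"
  shows "op_spectrum A \<noteq> {}"
  using E_null_if_disjoint_spectrum[of UNIV x] assms by (auto simp: E_UNIV)

lemma E_Compl:
  assumes B: "B \<in> sets borel" and "E B x = 0"
  shows "E (- B) x = x"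
proof -
  interpret finite_measure "scalar_measure E x" by (rule finite_scalar_measure)
  have "(norm (E (- B) x))\<^sup>2 = (norm x)\<^sup>2"
    using finite_measure_compl[of B] assms
    by (simp add: measure_scalar_measure E_UNIV Compl_eq_Diff_UNIV[symmetric])
  moreover have "Re (cinner x (E (- B) x)) = (norm (E (- B) x))\<^sup>2"
    using E_self_adjoint[of "- B" x x] cinner_E[of "- B" x] B
    by (metis Re_complex_of_real borel_comp)
  ultimately have "(norm (x - E (- B) x))\<^sup>2 = 0" by (simp add: norm_diff_squared)
  then show ?thesis by simp
qed

lemma Re_A_le:
  assumes "\<And>x. E {z. c < Re z} x = 0" and "(x, y) \<in> A"
  shows "Re (cinner y x) \<le> c * (norm x)\<^sup>2"
proof -
  have [measurable]: "{z. c < Re z} \<in> sets borel" by measurable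
  have "Re (1 * cinner y x) \<le> c * (norm x)\<^sup>2"
    using assms A_eq E_Compl[of "{z. c < Re z}" x]
    by (intro Re_spectral_integral_le[where B = "- {z. c < Re z}"]) auto
  then show ?thesis by simp
qed

lemma A_minus_bounded_below:
  assumes "\<And>x. E {z. c < Re z} x = 0" and "(x, y) \<in> A"
  shows "(Re l - c) * norm x \<le> norm (y - l *\<^sub>C x)"
proof (cases "x = 0")
  case False
  have "(Re l - c) * (norm x)\<^sup>2 \<le> Re (cinner (l *\<^sub>C x - y) x)"
    using Re_A_le[OF assms]
    by (simp add: cinner_diff_left cinner_scaleC_left cinner_same algebra_simps)
  also have "\<dots> \<le> norm (y - l *\<^sub>C x) * norm x"
    by (metis Re_cinner_le norm_minus_commute)
  finally show ?thesis using False by (simp add: power2_eq_square)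
qed simp

text \<open>A vector orthogonal to the range of \<open>A - l\<close> has no component in the spectral subspace of any
  disc \<open>B\<close>: there \<open>A - l\<close> is bounded and its real part is bounded away from 0.\<close>

lemma orthogonal_range_eq_0:
  assumes null: "\<And>x. E {z. c < Re z} x = 0" and l: "c < Re l"
    and orth: "\<And>x y. (x, y) \<in> A \<Longrightarrow> cinner p (y - l *\<^sub>C x) = 0"
  shows "p = 0"
proof -
  have "E (ball 0 n) p = 0" for n :: nat
  proof -
    define B where "B = ball (0::complex) n"
    have B: "B \<in> sets borel" by (simp add: B_def)
    obtain w where w: "\<And>k. w k \<in> Domain A" "w \<longlonglongrightarrow> p"
      using dense_A closure_sequential[of p "Domain A"] by auto
    \<comment> \<open>\<open>p\<close> need not lie in the domain, so the argument is run along domain vectors tending to \<open>p\<close>.\<close>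
    have bound: "(Re l - c) * norm (E B (w k)) \<le> (n + norm l) * norm (w k - p)" for k
    proof (cases "E B (w k) = 0")
      case False
      obtain v where "(w k, v) \<in> A" using w by blast
      then have uv: "(E B (w k), E B v) \<in> A"
        using spectral_integral_E[OF _ B] A_eq by blast
      define q where "q = E B v - l *\<^sub>C E B (w k)"
      have Bq: "E B q = q"
        using B bounded_linear.linear[OF bounded_linear_E[OF B]]
        by (simp add: q_def linear_diff E_scaleC E_idem)
      have "norm q \<le> (n + norm l) * norm (E B (w k))"
        using uv A_eq norm_triangle_ineq4 unfolding q_def
        by (intro norm_spectral_integral_diff_le[OF _ _ B E_idem[OF B]])
          (force simp: B_def dist_norm intro: order_trans[OF norm_triangle_ineq4])+
      have "cinner q p = 0" using orth[OF uv] by (metis cinner_commute complex_cnj_zero q_def)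
      then have "cinner q (E B (w k)) = cinner q (w k - p)"
        using E_self_adjoint[OF B, of q "w k"] by (simp add: Bq cinner_diff_right)
      have "(Re l - c) * (norm (E B (w k)))\<^sup>2 \<le> - Re (cinner q (E B (w k)))"
        using Re_A_le[OF null uv]
        by (simp add: q_def cinner_diff_left cinner_scaleC_left cinner_same algebra_simps)
      also have "\<dots> \<le> norm (cinner q (w k - p))"
        using abs_Re_le_cmod[of "cinner q (w k - p)"] \<open>cinner q (E B (w k)) = _\<close> by simp
      also have "\<dots> \<le> norm q * norm (w k - p)" by (rule cinner_Cauchy_Schwarz)
      also have "\<dots> \<le> (n + norm l) * norm (E B (w k)) * norm (w k - p)"
        by (intro mult_right_mono norm_ge_zero) fact
      finally show ?thesis using False by (simp add: power2_eq_square mult_ac)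
    qed simp
    have "(\<lambda>k. (Re l - c) * norm (E B (w k))) \<longlonglongrightarrow> (Re l - c) * norm (E B p)"
      by (intro tendsto_intros bounded_linear.tendsto[OF bounded_linear_E[OF B]] w)
    moreover have "(\<lambda>k. (n + norm l) * norm (w k - p)) \<longlonglongrightarrow> (n + norm l) * norm (p - p)"
      by (intro tendsto_intros w)
    ultimately have "(Re l - c) * norm (E B p) \<le> (n + norm l) * norm (p - p)"
      using bound by (intro LIMSEQ_le) auto
    then have "(Re l - c) * norm (E B p) \<le> 0" by simp
    then have "E B p = 0" using l by (simp add: mult_le_0_iff)
    then show ?thesis by (simp add: B_def)
  qed
  then have "E (\<Union>(range (\<lambda>n::nat. ball 0 n))) p = 0"
    by (intro E_countable_Union_eq_0) auto
  moreover have "\<Union>(range (\<lambda>n::nat. ball 0 n)) = (UNIV :: complex set)"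
    by (auto simp: reals_Archimedean2)
  ultimately show ?thesis by (simp add: E_UNIV)
qed

text \<open>Since \<open>Re (A x, x) \<le> c \<parallel>x\<parallel>\<^sup>2\<close>, the operator \<open>A - l\<close> is bounded below; as \<open>A\<close> is closed, its range \<open>S\<close>
  is closed, and the range has no orthogonal vectors, so it is the whole space.\<close>

lemma null_half_plane_imp_resolvent:
  assumes null: "\<And>x. E {z. c < Re z} x = 0" and l: "c < Re l"
  shows "l \<notin> op_spectrum A"
proof -
  define d where "d = Re l - c"
  have d: "d > 0" using l by (simp add: d_def)
  note below = A_minus_bounded_below[OF null, of _ _ l, folded d_def]
  have add: "(x + x', y + y') \<in> A" if "(x, y) \<in> A" "(x', y') \<in> A" for x y x' y'
    using linear_A that by (simp add: linear_operator_def)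
  have scale: "(a *\<^sub>C x, a *\<^sub>C y) \<in> A" if "(x, y) \<in> A" for a x y
    using linear_A that by (simp add: linear_operator_def)
  define S where "S = {y - l *\<^sub>C x | x y. (x, y) \<in> A}"
  have "S = UNIV"
  proof (rule closed_subspace_eq_UNIV)
    show "closed S"
    proof (unfold closed_sequential_limits, intro allI impI, elim conjE)
      fix f w assume f: "\<forall>n. f n \<in> S" "f \<longlonglongrightarrow> w"
      then have "\<forall>n. \<exists>x y. (x, y) \<in> A \<and> f n = y - l *\<^sub>C x" unfolding S_def by blast
      then obtain x y where xy: "\<And>n. (x n, y n) \<in> A" "\<And>n. f n = y n - l *\<^sub>C x n" by metis
      have le: "d * norm (x m - x n) \<le> norm (f m - f n)" for m n
        using below[OF A_diff[OF xy(1)[of m] xy(1)[of n]]]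
        by (simp add: xy(2) scaleC_diff_right algebra_simps)
      have "Cauchy x"
      proof (rule metric_CauchyI)
        fix e :: real assume "e > 0"
        then obtain N where "\<forall>m\<ge>N. \<forall>n\<ge>N. dist (f m) (f n) < d * e"
          using metric_CauchyD[OF LIMSEQ_imp_Cauchy[OF f(2)], of "d * e"] d by auto
        then have "d * norm (x m - x n) < d * e" if "m \<ge> N" "n \<ge> N" for m n
          using le[of m n] that by (fastforce simp: dist_norm)
        then show "\<exists>N. \<forall>m\<ge>N. \<forall>n\<ge>N. dist (x m) (x n) < e"
          using d by (auto simp: dist_norm)
      qed
      then obtain x0 where x0: "x \<longlonglongrightarrow> x0" using Cauchy_convergent_iff convergent_def by blast
      have "(\<lambda>n. norm (l *\<^sub>C x n - l *\<^sub>C x0)) \<longlonglongrightarrow> norm l * norm (x0 - x0)"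
        unfolding scaleC_diff_right[symmetric] norm_scaleC by (intro tendsto_intros x0)
      then have "(\<lambda>n. l *\<^sub>C x n) \<longlonglongrightarrow> l *\<^sub>C x0"
        by (subst LIM_zero_iff[symmetric], subst tendsto_norm_zero_iff[symmetric]) simp
      then have "(\<lambda>n. f n + l *\<^sub>C x n) \<longlonglongrightarrow> w + l *\<^sub>C x0" by (intro tendsto_add f)
      then have "(\<lambda>n. (x n, y n)) \<longlonglongrightarrow> (x0, w + l *\<^sub>C x0)"
        by (intro tendsto_Pair x0) (simp add: xy(2))
      then have "(x0, w + l *\<^sub>C x0) \<in> A"
        using closed_sequentially[OF closed_A, of "\<lambda>n. (x n, y n)"] xy(1) by simp
      moreover have "w = (w + l *\<^sub>C x0) - l *\<^sub>C x0" by simp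
      ultimately show "w \<in> S" unfolding S_def by blast
    qed
    show "0 \<in> S"
    proof -
      have "(0, 0) \<in> A" "0 = 0 - l *\<^sub>C (0::'a)" using linear_A by (auto simp: linear_operator_def)
      then show ?thesis unfolding S_def by blast
    qed
    show "u + v \<in> S" if uv: "u \<in> S" "v \<in> S" for u v
    proof -
      obtain x y x' y' where "(x, y) \<in> A" "u = y - l *\<^sub>C x" "(x', y') \<in> A" "v = y' - l *\<^sub>C x'"
        using uv unfolding S_def by blast
      then have "(x + x', y + y') \<in> A" "u + v = (y + y') - l *\<^sub>C (x + x')"
        using add by (auto simp: scaleC_add_right)
      then show ?thesis unfolding S_def by blast
    qed
    show "a *\<^sub>C u \<in> S" if u: "u \<in> S" for a u
    proof -
      obtain x y where "(x, y) \<in> A" "u = y - l *\<^sub>C x" using u unfolding S_def by blast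
      then have "(a *\<^sub>C x, a *\<^sub>C y) \<in> A" "a *\<^sub>C u = a *\<^sub>C y - l *\<^sub>C (a *\<^sub>C x)"
        using scale by (auto simp: scaleC_diff_right scaleC_scaleC mult.commute)
      then show ?thesis unfolding S_def by blast
    qed
    show "p = 0" if "\<forall>u\<in>S. cinner p u = 0" for p
      using orthogonal_range_eq_0[OF null l, of p] that unfolding S_def by blast
  qed
  then have "\<forall>w. \<exists>x y. (x, y) \<in> A \<and> w = y - l *\<^sub>C x" unfolding S_def by blast
  then obtain R G where R: "\<And>w. (R w, G w) \<in> A" "\<And>w. w = G w - l *\<^sub>C R w" by metis
  have unique: "x = R w" if "(x, y) \<in> A" "w = y - l *\<^sub>C x" for x y w
  proof -
    have "d * norm (x - R w) \<le> norm ((y - G w) - l *\<^sub>C (x - R w))"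
      by (rule below[OF A_diff[OF that(1) R(1)]])
    also have "\<dots> = norm ((y - l *\<^sub>C x) - (G w - l *\<^sub>C R w))"
      by (simp add: scaleC_diff_right algebra_simps)
    also have "\<dots> = 0" using R(2)[of w] that(2) by simp
    finally show ?thesis using d by (simp add: mult_le_0_iff)
  qed
  have R_add: "R (u + v) = R u + R v" for u v
  proof (rule unique[symmetric, OF add[OF R(1)[of u] R(1)[of v]]])
    have "u + v = (G u - l *\<^sub>C R u) + (G v - l *\<^sub>C R v)"
      by (rule arg_cong2[where f = "(+)", OF R(2) R(2)])
    then show "u + v = G u + G v - l *\<^sub>C (R u + R v)" by (simp add: scaleC_add_right)
  qed
  have R_scale: "R (a *\<^sub>C u) = a *\<^sub>C R u" for a u
  proof (rule unique[symmetric, OF scale[OF R(1)[of u]]])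
    have "a *\<^sub>C u = a *\<^sub>C (G u - l *\<^sub>C R u)" using R(2)[of u] by simp
    then show "a *\<^sub>C u = a *\<^sub>C G u - l *\<^sub>C a *\<^sub>C R u"
      by (simp add: scaleC_diff_right scaleC_scaleC mult.commute)
  qed
  have "bounded_clinear R"
    unfolding bounded_clinear_def
  proof (intro conjI allI R_scale bounded_linear_intro[where K = "1 / d"] R_add)
    show "R (r *\<^sub>R u) = r *\<^sub>R R u" for r u using R_scale[of "of_real r" u] by (simp add: scaleC_of_real)
    show "norm (R w) \<le> norm w * (1 / d)" for w
      using below[OF R(1)[of w]] d R(2)[of w] by (simp add: field_simps)
  qed
  moreover have "{(y - l *\<^sub>C x, x) | x y. (x, y) \<in> A} = op_graph R"
  proof (intro equalityI subsetI)
    fix p assume "p \<in> op_graph R"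
    then obtain w where "p = (w, R w)" by (auto simp: op_graph_def)
    then show "p \<in> {(y - l *\<^sub>C x, x) | x y. (x, y) \<in> A}" using R by blast
  qed (use unique in \<open>auto simp: op_graph_def\<close>)
  ultimately show ?thesis unfolding op_spectrum_def by blast
qed

end

section \<open>Orbits of a strongly continuous semigroup\<close>

locale strongly_continuous_semigroup =
  fixes T :: "real \<Rightarrow> 'a::complex_hilbert_space \<Rightarrow> 'a"
  assumes C0: "C0_semigroup T"
begin

lemma bounded_linear_T: "t \<ge> 0 \<Longrightarrow> bounded_linear (T t)"
  using C0 by (simp add: C0_semigroup_def bounded_clinear_def)

lemma T_0: "T 0 x = x"
  using C0 by (simp add: C0_semigroup_def)

lemma T_add: "s \<ge> 0 \<Longrightarrow> t \<ge> 0 \<Longrightarrow> T (s + t) x = T s (T t x)"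
  using C0 by (simp add: C0_semigroup_def)

lemma continuous_T_0: "continuous (at 0 within {0..}) (\<lambda>t. T t x)"
  using C0 by (simp add: C0_semigroup_def continuous_within at_within_Ici_at_right T_0)

text \<open>Otherwise the operators would be unbounded along some sequence of times tending to 0, although
  every orbit converges along it.\<close>

lemma bounded_near_0:
  obtains d K where "d > 0" "\<And>t x. 0 \<le> t \<Longrightarrow> t \<le> d \<Longrightarrow> norm (T t x) \<le> K * norm x"
proof -
  have "\<exists>d>0. \<exists>K. \<forall>t x. 0 \<le> t \<longrightarrow> t \<le> d \<longrightarrow> norm (T t x) \<le> K * norm x"
  proof (rule ccontr)
    assume "\<not> ?thesis"
    then have "\<exists>t x. 0 \<le> t \<and> t \<le> 1 / Suc n \<and> real n * norm x < norm (T t x)" for n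
      by (metis not_le of_nat_0_less_iff zero_less_Suc zero_less_divide_1_iff)
    then obtain t x where tx: "\<And>n. 0 \<le> t n" "\<And>n. t n \<le> 1 / Suc n"
        "\<And>n. real n * norm (x n) < norm (T (t n) (x n))" by metis
    have "t \<longlonglongrightarrow> 0"
      by (rule tendsto_sandwich[OF _ _ tendsto_const LIMSEQ_inverse_real_of_nat])
        (use tx in \<open>auto simp: inverse_eq_divide\<close>)
    have "bounded (range (\<lambda>n. T (t n) y))" for y
      using continuous_within_tendsto_compose'[OF continuous_T_0 _ \<open>t \<longlonglongrightarrow> 0\<close>] tx(1)
      by (intro convergent_imp_bounded) auto
    then obtain K where K: "\<And>n y. norm (T (t n) y) \<le> K * norm y"
      using uniform_boundedness[of "\<lambda>n. T (t n)"] bounded_linear_T tx(1) by blast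
    obtain n :: nat where "K \<le> real n" using real_arch_simple by blast
    then have "K * norm (x n) \<le> real n * norm (x n)" by (intro mult_right_mono) auto
    then show False using K[of n "x n"] tx(3)[of n] by linarith
  qed
  then show ?thesis using that by blast
qed

lemma bounded_on_interval:
  obtains K where "K \<ge> 0" "\<And>s x. 0 \<le> s \<Longrightarrow> s \<le> t \<Longrightarrow> norm (T s x) \<le> K * norm x"
proof -
  obtain d K where dK: "d > 0" "\<And>t x. 0 \<le> t \<Longrightarrow> t \<le> d \<Longrightarrow> norm (T t x) \<le> K * norm x"
    using bounded_near_0 by blast
  define L where "L = max K 0"
  have L: "norm (T t x) \<le> L * norm x" if "0 \<le> t" "t \<le> d" for t x
    using dK(2)[OF that, of x] mult_right_mono[of K L "norm x"] by (simp add: L_def)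
  have "L \<ge> 0" by (simp add: L_def)
  have pow: "norm (T (real n * s) x) \<le> L ^ n * norm x" if "0 \<le> s" "s \<le> d" for n s x
  proof (induction n)
    case (Suc n)
    have "T (real (Suc n) * s) x = T s (T (real n * s) x)"
      using T_add[of s "real n * s"] that by (simp add: algebra_simps)
    also have "norm \<dots> \<le> L * norm (T (real n * s) x)" using L that by blast
    also have "\<dots> \<le> L * (L ^ n * norm x)" using Suc \<open>L \<ge> 0\<close> by (intro mult_left_mono)
    finally show ?case by simp
  qed (simp add: T_0)
  obtain n :: nat where n: "t / d \<le> real n" using real_arch_simple by blast
  define m where "m = Suc n"
  have m: "t \<le> d * real m" "m > 0" using n dK(1) by (auto simp: m_def field_simps)
  have "norm (T s x) \<le> L ^ m * norm x" if "0 \<le> s" "s \<le> t" for s x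
    using pow[of "s / m" m x] that m by (simp add: field_simps)
  then show ?thesis using \<open>L \<ge> 0\<close> that[of "L ^ m"] by simp
qed

lemma norm_T_diff_le:
  assumes K: "\<And>s x. 0 \<le> s \<Longrightarrow> s \<le> b \<Longrightarrow> norm (T s x) \<le> K * norm x"
    and "0 \<le> s" "s \<le> b" "0 \<le> t" "t \<le> b"
  shows "norm (T s x - T t x) \<le> K * norm (T \<bar>s - t\<bar> x - x)"
proof -
  have *: "norm (T v x - T u x) \<le> K * norm (T (v - u) x - x)" if "0 \<le> u" "u \<le> v" "v \<le> b" for u v
  proof -
    have "T v x - T u x = T u (T (v - u) x - x)"
      using T_add[of u "v - u" x] that bounded_linear.linear[OF bounded_linear_T, of u]
      by (simp add: linear_diff)
    then show ?thesis using K[of u] that by simp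
  qed
  show ?thesis
    using *[of s t] *[of t s] assms by (cases "s \<le> t") (auto simp: norm_minus_commute abs_if)
qed

lemma continuous_on_T: "continuous_on {0..b} (\<lambda>t. T t x)"
  unfolding continuous_on_def
proof
  fix t assume t: "t \<in> {0..b}"
  obtain K where "K \<ge> 0" and K: "\<And>s x. 0 \<le> s \<Longrightarrow> s \<le> b \<Longrightarrow> norm (T s x) \<le> K * norm x"
    using bounded_on_interval[of b] by blast
  have "((\<lambda>s. T \<bar>s - t\<bar> x) \<longlongrightarrow> T 0 x) (at t within {0..b})"
    by (rule continuous_within_tendsto_compose'[OF continuous_T_0])
      (auto intro!: tendsto_eq_intros)
  then have "((\<lambda>s. K * norm (T \<bar>s - t\<bar> x - x)) \<longlongrightarrow> K * norm (x - x)) (at t within {0..b})"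
    by (intro tendsto_intros) (simp add: T_0)
  then have "((\<lambda>s. K * norm (T \<bar>s - t\<bar> x - x)) \<longlongrightarrow> 0) (at t within {0..b})" by simp
  moreover have "\<forall>\<^sub>F s in at t within {0..b}. norm (T s x - T t x) \<le> K * norm (T \<bar>s - t\<bar> x - x)"
    unfolding eventually_at_filter
    by (rule always_eventually) (use t norm_T_diff_le[OF K] in simp)
  ultimately have "((\<lambda>s. T s x - T t x) \<longlongrightarrow> 0) (at t within {0..b})"
    by (rule Lim_null_comparison[rotated])
  then show "((\<lambda>s. T s x) \<longlongrightarrow> T t x) (at t within {0..b})" by (simp add: LIM_zero_iff)
qed

lemma generator_invariant:
  assumes xy: "(x, y) \<in> generator T" and t: "t \<ge> 0"
  shows "(T t x, T t y) \<in> generator T"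
proof -
  interpret bounded_linear "T t" using t by (rule bounded_linear_T)
  have "((\<lambda>h. T t ((T h x - x) /\<^sub>R h)) \<longlongrightarrow> T t y) (at_right 0)"
    using xy by (intro tendsto) (simp add: generator_def)
  moreover have "\<forall>\<^sub>F h in at_right 0. T t ((T h x - x) /\<^sub>R h) = (T h (T t x) - T t x) /\<^sub>R h"
    using eventually_at_right_less[of 0]
  proof eventually_elim
    case (elim h)
    then have "T t (T h x) = T h (T t x)"
      using T_add[of t h x] T_add[of h t x] t by (simp add: add.commute)
    then show ?case by (simp add: scaleR diff)
  qed
  ultimately have "((\<lambda>h. (T h (T t x) - T t x) /\<^sub>R h) \<longlongrightarrow> T t y) (at_right 0)"
    by (rule Lim_transform_eventually)
  then show ?thesis by (simp add: generator_def)
qed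

text \<open>The difference quotients from either side of \<open>t\<close> have the form \<open>T(min s t)\<close> applied to the difference
  quotient at 0, which converges to \<open>y\<close>.\<close>

lemma has_vector_derivative_T:
  assumes xy: "(x, y) \<in> generator T" and t: "t > 0"
  shows "((\<lambda>s. T s x) has_vector_derivative T t y) (at t)"
proof -
  define q where "q h = (T h x - x) /\<^sub>R h" for h
  obtain K where K: "K \<ge> 0" "\<And>s x. 0 \<le> s \<Longrightarrow> s \<le> t + 1 \<Longrightarrow> norm (T s x) \<le> K * norm x"
    using bounded_on_interval[of "t + 1"] by blast
  have "(q \<longlongrightarrow> y) (at_right 0)" using xy unfolding generator_def q_def by blast
  moreover have "filterlim (\<lambda>s. \<bar>s - t\<bar>) (at_right 0) (at t)"
    unfolding filterlim_at by (auto intro!: tendsto_eq_intros simp: eventually_at_filter)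
  ultimately have q: "((\<lambda>s. q \<bar>s - t\<bar>) \<longlongrightarrow> y) (at t)"
    by (rule filterlim_compose)
  have "((\<lambda>s. T (min s t) y) \<longlongrightarrow> T t y) (at t)"
  proof (rule continuous_within_tendsto_compose[where f = "\<lambda>s. T s y" and S = "{0..t}" and a = t])
    show "continuous (at t within {0..t}) (\<lambda>s. T s y)"
      using continuous_on_T[of t y] t by (simp add: continuous_on_eq_continuous_within)
    show "\<forall>\<^sub>F s in at t. min s t \<in> {0..t}"
      using eventually_at_in_open'[of "{0<..}" t] t by (auto elim!: eventually_mono)
    show "((\<lambda>s. min s t) \<longlongrightarrow> t) (at t)" by (auto intro!: tendsto_eq_intros)
  qed
  then have lim: "((\<lambda>s. K * norm (q \<bar>s - t\<bar> - y) + norm (T (min s t) y - T t y))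
      \<longlongrightarrow> K * norm (y - y) + norm (T t y - T t y)) (at t)"
    by (intro tendsto_intros q)
  have "((\<lambda>s. (T s x - T t x) /\<^sub>R (s - t) - T t y) \<longlongrightarrow> 0) (at t)"
  proof (rule Lim_null_comparison)
    have "\<forall>\<^sub>F s in at t. s \<in> {0<..<t + 1} \<and> s \<noteq> t"
      using eventually_at_in_open[of "{0<..<t + 1}" t] t by simp
    then show "\<forall>\<^sub>F s in at t. norm ((T s x - T t x) /\<^sub>R (s - t) - T t y)
        \<le> K * norm (q \<bar>s - t\<bar> - y) + norm (T (min s t) y - T t y)"
    proof eventually_elim
      case (elim s)
      define m where "m = min s t"
      have m: "m \<ge> 0" "m \<le> t + 1" using elim t by (auto simp: m_def)
      interpret bounded_linear "T m" using m by (intro bounded_linear_T)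
      have "(T s x - T t x) /\<^sub>R (s - t) = T m (q \<bar>s - t\<bar>)"
      proof (cases "s < t")
        case True
        then have "T t x = T m (T (t - s) x)"
          using T_add[of m "t - s" x] m by (simp add: m_def)
        then have "T m (q \<bar>s - t\<bar>) = (T t x - T m x) /\<^sub>R (t - s)"
          using True by (simp add: q_def scaleR diff)
        also have "T m x = T s x" using True by (simp add: m_def)
        also have "(T t x - T s x) /\<^sub>R (t - s) = (- (T t x - T s x)) /\<^sub>R (- (t - s))"
          by (simp only: inverse_minus_eq scaleR_minus_left scaleR_minus_right minus_minus)
        finally show ?thesis by simp
      next
        case False
        then have "T s x = T m (T (s - t) x)"
          using T_add[of m "s - t" x] m elim by (simp add: m_def)
        moreover have "T m x = T t x" using False by (simp add: m_def)
        ultimately show ?thesis using False by (simp add: q_def scaleR diff)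
      qed
      then have "(T s x - T t x) /\<^sub>R (s - t) - T t y = T m (q \<bar>s - t\<bar> - y) + (T m y - T t y)"
        by (simp add: diff)
      also have "norm \<dots> \<le> norm (T m (q \<bar>s - t\<bar> - y)) + norm (T m y - T t y)"
        by (rule norm_triangle_ineq)
      also have "norm (T m (q \<bar>s - t\<bar> - y)) \<le> K * norm (q \<bar>s - t\<bar> - y)" by (rule K(2)[OF m])
      finally show ?case by (simp add: m_def)
    qed
    show "((\<lambda>s. K * norm (q \<bar>s - t\<bar> - y) + norm (T (min s t) y - T t y)) \<longlongrightarrow> 0) (at t)"
      using lim by simp
  qed
  then have "((\<lambda>s. norm ((T s x - T t x) /\<^sub>R (s - t) - T t y)) \<longlongrightarrow> 0) (at t)"
    by (rule tendsto_norm_zero)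
  then have "((\<lambda>s. norm (T s x - T t x - (s - t) *\<^sub>R T t y) / norm (s - t)) \<longlongrightarrow> 0) (at t)"
  proof (rule Lim_transform_eventually)
    have "norm ((T s x - T t x) /\<^sub>R (s - t) - T t y)
        = norm (T s x - T t x - (s - t) *\<^sub>R T t y) / norm (s - t)" if "s \<noteq> t" for s
    proof -
      have "(T s x - T t x) /\<^sub>R (s - t) - T t y = (T s x - T t x - (s - t) *\<^sub>R T t y) /\<^sub>R (s - t)"
        using that by (simp add: scaleR_diff_right)
      then show ?thesis by (simp add: divide_inverse mult.commute)
    qed
    then show "\<forall>\<^sub>F s in at t. norm ((T s x - T t x) /\<^sub>R (s - t) - T t y)
        = norm (T s x - T t x - (s - t) *\<^sub>R T t y) / norm (s - t)"
      by (auto simp: eventually_at_filter)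
  qed
  then show ?thesis
    by (simp add: has_vector_derivative_def has_derivative_iff_norm bounded_linear_scaleR_left)
qed

end

section \<open>Energy estimates and the growth bound\<close>

lemma exp_le_if_derivative_ge:
  fixes f f' :: "real \<Rightarrow> real"
  assumes t: "t \<ge> 0" and cont: "continuous_on {0..t} f"
    and deriv: "\<And>s. 0 < s \<Longrightarrow> (f has_real_derivative f' s) (at s)"
    and ge: "\<And>s. 0 < s \<Longrightarrow> a * f s \<le> f' s"
  shows "exp (a * t) * f 0 \<le> f t"
proof -
  have "exp (- a * 0) * f 0 \<le> exp (- a * t) * f t"
  proof (rule DERIV_nonneg_imp_increasing_open[OF t])
    fix s :: real assume s: "0 < s"
    have "((\<lambda>s. exp (- a * s) * f s) has_real_derivative exp (- a * s) * (f' s - a * f s)) (at s)"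
      by (auto intro!: derivative_eq_intros deriv[OF s] simp: algebra_simps)
    moreover have "exp (- a * s) * (f' s - a * f s) \<ge> 0" using ge[OF s] by simp
    ultimately show "\<exists>y. ((\<lambda>s. exp (- a * s) * f s) has_real_derivative y) (at s) \<and> y \<ge> 0"
      by blast
  qed (intro continuous_intros cont)
  then have "exp (a * t) * f 0 \<le> exp (a * t) * (exp (- a * t) * f t)" by simp
  also have "\<dots> = f t" by (simp add: mult.assoc[symmetric] exp_add[symmetric])
  finally show ?thesis .
qed

locale resolved_semigroup = strongly_continuous_semigroup T + resolved_operator E A
  for T :: "real \<Rightarrow> 'a::complex_hilbert_space \<Rightarrow> 'a" and E A +
  assumes A_generator: "A = generator T"
begin

lemma orbit_in_A: "(x, y) \<in> A \<Longrightarrow> t \<ge> 0 \<Longrightarrow> (T t x, T t y) \<in> A"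
  using generator_invariant A_generator by blast

lemma energy_derivative:
  assumes "(x, y) \<in> A" and t: "t > 0" and B: "B \<in> sets borel"
  shows "((\<lambda>s. (norm (E B (T s x)))\<^sup>2) has_real_derivative
    2 * Re (cinner (E B (T t y)) (E B (T t x)))) (at t)"
proof -
  let ?u = "\<lambda>s. E B (T s x)"
  have u: "(?u has_vector_derivative E B (T t y)) (at t)"
    using assms A_generator
    by (intro bounded_linear.has_vector_derivative[OF bounded_linear_E[OF B]] has_vector_derivative_T)
      simp_all
  have "((\<lambda>s. cinner (?u s) (?u s)) has_vector_derivative
      cinner (?u t) (E B (T t y)) + cinner (E B (T t y)) (?u t)) (at t)"
    by (rule bounded_bilinear.has_vector_derivative[OF bounded_bilinear_cinner u u])
  then have "((\<lambda>s. Re (cinner (?u s) (?u s))) has_vector_derivative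
      Re (cinner (?u t) (E B (T t y)) + cinner (E B (T t y)) (?u t))) (at t)"
    by (rule bounded_linear.has_vector_derivative[OF bounded_linear_Re])
  moreover have "Re (cinner (?u t) (E B (T t y))) = Re (cinner (E B (T t y)) (?u t))"
    by (metis cinner_commute cnj.simps(1))
  ultimately show ?thesis
    by (simp add: Re_cinner_same has_real_derivative_iff_has_vector_derivative)
qed

lemma continuous_on_energy:
  assumes "B \<in> sets borel"
  shows "continuous_on {0..t} (\<lambda>s. (norm (E B (T s x)))\<^sup>2)"
  by (intro continuous_intros continuous_on_T
      bounded_linear.continuous_on[OF bounded_linear_E[OF assms]])

text \<open>For \<open>u = E(B)T(s)x\<close> the energy \<open>\<parallel>u\<parallel>\<^sup>2\<close> has derivative \<open>2 Re (A u, u)\<close>, and \<open>Re (A u, u) \<ge> c \<parallel>u\<parallel>\<^sup>2\<close>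
  because \<open>u\<close> lies in the range of \<open>E(B)\<close>.\<close>

lemma growth_of_component:
  assumes xy: "(x, y) \<in> A" and t: "t \<ge> 0"
    and B: "B \<in> sets borel" "\<And>z. z \<in> B \<Longrightarrow> c \<le> Re z"
  shows "exp (c * t) * norm (E B x) \<le> norm (E B (T t x))"
proof -
  have "exp (2 * c * t) * (norm (E B (T 0 x)))\<^sup>2 \<le> (norm (E B (T t x)))\<^sup>2"
  proof (rule exp_le_if_derivative_ge[OF t continuous_on_energy[OF B(1)] energy_derivative[OF xy _ B(1)]])
    fix s :: real assume "0 < s"
    then have "(E B (T s x), E B (T s y)) \<in> spectral_integral E (\<lambda>z. z)"
      using orbit_in_A[OF xy, of s] spectral_integral_E[OF _ B(1)] A_eq by auto
    then have "Re (- 1 * cinner (E B (T s y)) (E B (T s x))) \<le> - c * (norm (E B (T s x)))\<^sup>2"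
      by (rule Re_spectral_integral_le[OF _ _ B(1) E_idem[OF B(1)]]) (use B(2) in auto)
    then show "2 * c * (norm (E B (T s x)))\<^sup>2 \<le> 2 * Re (cinner (E B (T s y)) (E B (T s x)))"
      by simp
  qed
  moreover have "exp (2 * c * t) = (exp (c * t))\<^sup>2"
    by (simp add: exp_double mult.assoc)
  ultimately have "(exp (c * t) * norm (E B x))\<^sup>2 \<le> (norm (E B (T t x)))\<^sup>2"
    by (simp add: T_0 power_mult_distrib)
  then show ?thesis by (simp add: power2_le_iff_abs_le)
qed

text \<open>A vector in the spectral subspace of the half-plane would have to grow by the factor
  \<open>e\<^sup>c\<^sup>t\<close> up to time \<open>t\<close>, which is more than \<open>T(t)\<close> allows.\<close>

lemma norm_bound_imp_null_half_plane:
  assumes t: "t \<ge> 0" and K: "\<And>x. norm (T t x) \<le> K * norm x" and less: "K < exp (c * t)"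
  shows "E {z. c \<le> Re z} x = 0"
proof (rule E_eq_0_if_on_domain)
  show B: "{z. c \<le> Re z} \<in> sets borel" by measurable
  fix x y assume xy: "(x, y) \<in> A"
  define u where "u = E {z. c \<le> Re z} x"
  have "(u, E {z. c \<le> Re z} y) \<in> A"
    using spectral_integral_E[OF _ B] xy A_eq unfolding u_def by blast
  from growth_of_component[OF this t B]
  have "exp (c * t) * norm u \<le> norm (E {z. c \<le> Re z} (T t u))"
    by (simp add: u_def E_idem B)
  also have "\<dots> \<le> norm (T t u)" by (rule norm_E_le[OF B])
  also have "\<dots> \<le> K * norm u" by (rule K)
  finally have "(exp (c * t) - K) * norm u \<le> 0" by (simp add: algebra_simps)
  then show "E {z. c \<le> Re z} x = 0" using less by (simp add: mult_le_0_iff u_def)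
qed

text \<open>The same energy argument from above, applied to \<open>-\<parallel>T(s)x\<parallel>\<^sup>2\<close> so that the lower estimate for
  solutions of differential inequalities can be reused.\<close>

lemma null_half_plane_imp_norm_bound:
  assumes null: "\<And>x. E {z. c < Re z} x = 0" and t: "t \<ge> 0"
  shows "norm (T t x) \<le> exp (c * t) * norm x"
proof (rule dense_induct[where P = "\<lambda>x. norm (T t x) \<le> exp (c * t) * norm x"])
  show "closed {x. norm (T t x) \<le> exp (c * t) * norm x}"
    by (intro closed_Collect_le continuous_intros linear_continuous_on bounded_linear_T t)
  fix x y assume xy: "(x, y) \<in> A"
  have "exp (2 * c * t) * - (norm (T 0 x))\<^sup>2 \<le> - (norm (T t x))\<^sup>2"
  proof (rule exp_le_if_derivative_ge[OF t])
    show "continuous_on {0..t} (\<lambda>s. - (norm (T s x))\<^sup>2)"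
      by (intro continuous_intros continuous_on_T)
    fix s :: real assume s: "0 < s"
    show "((\<lambda>s. - (norm (T s x))\<^sup>2) has_real_derivative - (2 * Re (cinner (T s y) (T s x)))) (at s)"
      using energy_derivative[OF xy s, of UNIV] by (intro DERIV_minus) (simp add: E_UNIV)
    show "2 * c * - (norm (T s x))\<^sup>2 \<le> - (2 * Re (cinner (T s y) (T s x)))"
      using Re_A_le[OF null orbit_in_A[OF xy]] s by simp
  qed
  moreover have "exp (2 * c * t) = (exp (c * t))\<^sup>2"
    by (simp add: exp_double mult.assoc)
  ultimately have "(norm (T t x))\<^sup>2 \<le> (exp (c * t) * norm x)\<^sup>2"
    by (simp add: T_0 power_mult_distrib)
  then show "norm (T t x) \<le> exp (c * t) * norm x" by (simp add: power2_le_iff_abs_le)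
qed

lemma Re_spectrum_le_if_norm_bound:
  assumes "t \<ge> 0" "\<And>x. norm (T t x) \<le> K * norm x" "K < exp (c * t)" and l: "l \<in> op_spectrum A"
  shows "Re l \<le> c"
proof (rule ccontr)
  assume "\<not> Re l \<le> c"
  moreover have "E {z. c < Re z} x = 0" for x
    by (rule E_null_subset[OF _ _ _ norm_bound_imp_null_half_plane[OF assms(1-3)]]) auto
  ultimately show False using null_half_plane_imp_resolvent[of c l] l by simp
qed

lemma norm_T_le: "t \<ge> 0 \<Longrightarrow> norm (T t x) \<le> onorm (T t) * norm x"
  by (rule onorm[OF bounded_linear_T])

lemma Re_spectrum_le_if_exp_bounded:
  assumes bound: "exp_bounded T M w" and M: "M \<ge> 1" and l: "l \<in> op_spectrum A"
  shows "Re l \<le> w"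
proof (rule field_le_epsilon)
  fix e :: real assume e: "e > 0"
  \<comment> \<open>At this time the exponential gain beats the factor \<open>M\<close>.\<close>
  define t where "t = ln (2 * M) / e"
  have t: "t \<ge> 0" using e M by (simp add: t_def)
  have "M < 2 * M" using M by simp
  also have "2 * M = exp (e * t)" using e M by (simp add: t_def)
  finally have "M * exp (w * t) < exp (e * t) * exp (w * t)" by simp
  then have less: "M * exp (w * t) < exp ((w + e) * t)"
    by (simp add: exp_add[symmetric] algebra_simps)
  have "norm (T t x) \<le> M * exp (w * t) * norm x" for x
    using norm_T_le[OF t, of x] bound t mult_right_mono[of "onorm (T t)" _ "norm x"]
    unfolding exp_bounded_def by (meson norm_ge_zero order_trans)
  then show "Re l \<le> w + e" using Re_spectrum_le_if_norm_bound[OF t _ less l] by blast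
qed

lemma exp_bounded_if_Re_spectrum_le:
  assumes "\<And>l. l \<in> op_spectrum A \<Longrightarrow> Re l \<le> w"
  shows "exp_bounded T 1 w"
proof -
  have "{z. w < Re z} \<inter> op_spectrum A = {}" using assms by fastforce
  then have "E {z. w < Re z} x = 0" for x by (intro E_null_if_disjoint_spectrum) auto
  then show ?thesis
    unfolding exp_bounded_def by (auto intro!: onorm_bound null_half_plane_imp_norm_bound)
qed

text \<open>Boundedness of the single operator \<open>T(1)\<close> is enough, as \<open>e\<^sup>c > \<parallel>T(1)\<parallel>\<close> for large \<open>c\<close>.\<close>

lemma spectrum_bounded_above: "\<exists>c. \<forall>l\<in>op_spectrum A. Re l \<le> c"
proof -
  define c where "c = onorm (T 1) + 1"
  have "onorm (T 1) < exp (c * 1)"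
    using exp_ge_add_one_self[of c] by (simp add: c_def)
  then show ?thesis using Re_spectrum_le_if_norm_bound[of 1 "onorm (T 1)"] norm_T_le[of 1] by auto
qed

end

theorem proposition3p2:
  fixes T :: "real \<Rightarrow> 'a::complex_hilbert_space \<Rightarrow> 'a"
    and A :: "('a \<times> 'a) set"
    and E :: "complex set \<Rightarrow> 'a \<Rightarrow> 'a"
  assumes nontrivial: "\<exists>x::'a. x \<noteq> 0"
    and semigroup: "C0_semigroup T"
    and normal_T: "\<And>t. t \<ge> 0 \<Longrightarrow> normal_operator (op_graph (T t))"
    and generator: "A = generator T"
    and normal_A: "normal_operator A"
    and spectral_measure: "spectral_measure_of A E"
  shows "\<exists>\<omega>\<^sub>0::real.
    growth_bound T = ereal \<omega>\<^sub>0 \<and> spectral_bound A = ereal \<omega>\<^sub>0 \<and>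
    (\<forall>t\<ge>0. onorm (T t) \<le> exp (\<omega>\<^sub>0 * t)) \<and>
    (\<exists>M\<ge>1. exp_bounded T M \<omega>\<^sub>0) \<and>
    (\<forall>\<omega>. (\<exists>M\<ge>1. exp_bounded T M \<omega>) \<longrightarrow> \<omega>\<^sub>0 \<le> \<omega>) \<and>
    exp_bounded T 1 \<omega>\<^sub>0 \<and>
    (\<forall>M\<ge>1. exp_bounded T M \<omega>\<^sub>0 \<longrightarrow> 1 \<le> M)"
proof -
  interpret resolved_semigroup T E A
    using semigroup normal_A spectral_measure generator
    by unfold_locales (simp_all add: normal_operator_def spectral_measure_of_def)
  define w where "w = (SUP l\<in>op_spectrum A. Re l)"
  have ne: "op_spectrum A \<noteq> {}" using nontrivial spectrum_nonempty by blast
  have bdd: "bdd_above (Re ` op_spectrum A)"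
    using spectrum_bounded_above by (auto intro: bdd_aboveI2)
  have le_w: "Re l \<le> w" if "l \<in> op_spectrum A" for l
    unfolding w_def using that bdd by (rule cSUP_upper)
  have w_least: "w \<le> v" if "\<And>l. l \<in> op_spectrum A \<Longrightarrow> Re l \<le> v" for v
    unfolding w_def using ne that by (rule cSUP_least)
  have bounded_w: "exp_bounded T 1 w" by (rule exp_bounded_if_Re_spectrum_le[OF le_w])
  have minimal: "w \<le> v" if "M \<ge> 1" "exp_bounded T M v" for M v
    using Re_spectrum_le_if_exp_bounded[OF that(2,1)] by (rule w_least)
  have spectral: "spectral_bound A = ereal w"
    unfolding spectral_bound_def
  proof (rule SUP_eqI)
    fix y assume y: "\<And>l. l \<in> op_spectrum A \<Longrightarrow> ereal (Re l) \<le> y"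
    show "ereal w \<le> y"
      using y ne w_least by (cases y) auto
  qed (simp add: le_w)
  have growth: "growth_bound T = ereal w"
    unfolding growth_bound_def
  proof (rule INF_eqI)
    fix y assume "\<And>v. v \<in> {\<omega>. \<exists>M\<ge>1. exp_bounded T M \<omega>} \<Longrightarrow> y \<le> ereal v"
    then show "y \<le> ereal w" using bounded_w by blast
  qed (use minimal in auto)
  show ?thesis
    by (rule exI[of _ w])
      (use growth spectral bounded_w minimal in \<open>auto simp: exp_bounded_def\<close>)
qed

end
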